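(* Let $\Bbbk$ be a field of characteristic zero and let $m\ge 3$ be an integer. Then the artinian algebra $A(T_{m,3})$ has the weak Lefschetz property if and only if $m\in\{3,4,5,6,7,8,10,11,14\}$.
   Context: For integers $m\ge 3$, $n\ge 1$, the tadpole graph $T_{m,n}$ is the simple graph with vertex set $\{x_1,\dots,x_m,y_1,\dots,y_n\}$ and edges $\{x_i,x_{i+1}\}$ for $1\le i\le m-1$, $\{x_m,x_1\}$ (so the $x_i$ form an $m$-cycle), $\{y_j,y_{j+1}\}$ for $1\le j\le n-1$ (so the $y_j$ form a path), and the bridge $\{x_m,y_1\}$. For a simple graph $G$ on vertices $1,\dots,N$, let $R=\Bbbk[x_1,\dots,x_N]$ be the standard graded polynomial ring, $I(G)=(x_ix_j : \{i,j\}\text{ an edge of }G)$ its edge ideal, and $A(G)=R/\big((x_1^2,\dots,x_N^2)+I(G)\big)$, a standard graded artinian algebra $A=\bigoplus_{j=0}^s [A]_j$. Such an $A$ has the weak Lefschetz property (WLP) if there is a linear form $\ell\in[A]_1$ such that multiplication $\times\ell:[A]_j\to[A]_{j+1}$ is injective or surjective for every $j=0,\dots,s-1$. *)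

theory Defs
  imports Main "HOL-Library.Poly_Mapping"
begin

text \<open>Multivariate polynomials over a coefficient ring 'k in variables indexed by nat:
  a polynomial is a finitely supported map from exponent vectors (monomials) to coefficients.
  Multiplication of poly_mapping is the usual polynomial (convolution) product.\<close>

type_synonym 'k mpoly = "(nat \<Rightarrow>\<^sub>0 nat) \<Rightarrow>\<^sub>0 'k"

definition Var :: "nat \<Rightarrow> 'k::comm_ring_1 mpoly" where
  "Var i = Poly_Mapping.single (Poly_Mapping.single i 1) 1"

definition mdeg :: "(nat \<Rightarrow>\<^sub>0 nat) \<Rightarrow> nat" where
  "mdeg \<alpha> = (\<Sum>i\<in>Poly_Mapping.keys \<alpha>. Poly_Mapping.lookup \<alpha> i)"

definition polyring :: "nat \<Rightarrow> 'k::comm_ring_1 mpoly set" where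
  "polyring N = {p. \<forall>\<alpha>\<in>Poly_Mapping.keys p. Poly_Mapping.keys \<alpha> \<subseteq> {1..N}}"

definition homog_part :: "nat \<Rightarrow> nat \<Rightarrow> 'k::comm_ring_1 mpoly set" where
  "homog_part N j = {p \<in> polyring N. \<forall>\<alpha>\<in>Poly_Mapping.keys p. mdeg \<alpha> = j}"

inductive_set ideal_gen :: "'k::comm_ring_1 mpoly set \<Rightarrow> 'k mpoly set \<Rightarrow> 'k mpoly set"
  for R :: "'k mpoly set" and gens :: "'k mpoly set" where
  zero: "0 \<in> ideal_gen R gens"
| gen: "g \<in> gens \<Longrightarrow> r \<in> R \<Longrightarrow> r * g \<in> ideal_gen R gens"
| add: "p \<in> ideal_gen R gens \<Longrightarrow> q \<in> ideal_gen R gens \<Longrightarrow> p + q \<in> ideal_gen R gens"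

text \<open>For a simple graph G on vertices 1..N with edge set E (2-element subsets of {1..N}):
  the ideal (x_1^2,...,x_N^2) + I(G) of R, whose quotient is A(G).\<close>
definition artin_ideal :: "'k::comm_ring_1 itself \<Rightarrow> nat \<Rightarrow> nat set set \<Rightarrow> 'k mpoly set" where
  "artin_ideal _ N E = ideal_gen (polyring N)
     ({Var i ^ 2 | i. i \<in> {1..N}} \<union> {Var i * Var j | i j. {i, j} \<in> E})"

definition socle_degree :: "'k::comm_ring_1 itself \<Rightarrow> nat \<Rightarrow> nat set set \<Rightarrow> nat" where
  "socle_degree K N E =
     (GREATEST j. \<exists>f \<in> (homog_part N j :: 'k mpoly set). f \<notin> artin_ideal K N E)"

text \<open>Weak Lefschetz property of A(G) = R/((x_i^2) + I(G)): there is a linear form l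
  (represented by an element of [R]_1) such that multiplication by l from [A]_j to [A]_{j+1}
  is injective or surjective for every j = 0, ..., s-1.\<close>
definition has_WLP :: "'k::comm_ring_1 itself \<Rightarrow> nat \<Rightarrow> nat set set \<Rightarrow> bool" where
  "has_WLP K N E =
     (\<exists>l \<in> (homog_part N 1 :: 'k mpoly set). \<forall>j < socle_degree K N E.
        (\<forall>f \<in> homog_part N j. l * f \<in> artin_ideal K N E \<longrightarrow> f \<in> artin_ideal K N E)
      \<or> (\<forall>g \<in> homog_part N (Suc j). \<exists>f \<in> homog_part N j. g - l * f \<in> artin_ideal K N E))"

text \<open>Tadpole graph T_{m,n}: vertex x_i is numbered i (1 \<le> i \<le> m),
  vertex y_j is numbered m + j (1 \<le> j \<le> n); N = m + n vertices.\<close>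
definition tadpole_edges :: "nat \<Rightarrow> nat \<Rightarrow> nat set set" where
  "tadpole_edges m n =
     {{i, i + 1} | i. 1 \<le> i \<and> i \<le> m - 1}
   \<union> {{m, 1}}
   \<union> {{m + j, m + j + 1} | j. 1 \<le> j \<and> j \<le> n - 1}
   \<union> {{m, m + 1}}"

end

theory Submission
  imports Defs "HOL-Computational_Algebra.Polynomial"
begin

text \<open>
  The classes of the independent j-sets form a basis of the degree-j part of A(G), so everything is about
  inclusion matrices between independent sets. The graph is the path 1, ..., m+3 with the chord {1, m}.

  Failure. The form annihilates a nonzero element of degree ceil((m+3)/4), a product of linear forms
  attached to blocks of four consecutive vertices. An induced matching with d edges yields a functional
  on degree d that annihilates the image of the form, and there is one for every d up to 1 + floor(m/3).
  Hence both injectivity and surjectivity fail in degree ceil((m+3)/4) if this is at most floor(m/3),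
  and that is the case exactly for the m outside the list.

  Success. Here the form is the sum of the variables. If v is a leaf with neighbour w, then A(G) is, as
  a module over k[t] with t acting by the form, the direct sum of the tensor product of A(G - v - w) with
  k[t]/(t^2) and of A(G - N[w]) shifted by one. By the Clebsch-Gordan rule this reduces the injectivity
  and surjectivity of powers of the form to the same questions for smaller graphs; for paths the recursion
  is finite and can be evaluated. Cycles are reduced to paths by deleting a vertex, which is enough except
  for one degree of surjectivity when m is 2 modulo 3.
\<close>

section \<open>Independent sets\<close>

text \<open>Why powers occur: tensoring with k[t]/(t^2) turns a string of length n into strings of
  lengths n+1 and n-1, so even the first power of the form on the tadpole leads to second and third
  powers on smaller graphs. The recursion is therefore stated for all powers. Characteristic zero
  enters through the integer factors produced by the double counts.

  Why exactly this list: for the listed m one has ceil((m+3)/4) = 1 + floor(m/3). Below this degree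
  surjectivity is excluded, and in it injectivity is excluded, so for each of these degrees only one
  of the two properties can hold, and that one is what has to be proved.

  The obstacle is the cycle with m = 3q+2 vertices. The link of a vertex is then a path with 3q-1
  vertices, on which the transposed map in the critical degree has a one-dimensional kernel, so that
  a single deletion cannot succeed. The kernel elements seen from the links of two different
  vertices pair up the remaining vertices in incompatible ways, and this forces them to
  vanish.\<close>

definition indep :: "'a set set \<Rightarrow> 'a set \<Rightarrow> bool" where
  "indep E S \<longleftrightarrow> (\<forall>u\<in>S. \<forall>v\<in>S. u \<noteq> v \<longrightarrow> {u, v} \<notin> E)"

definition ind :: "'a set set \<Rightarrow> 'a set \<Rightarrow> nat \<Rightarrow> 'a set set" where
  "ind E V j = {S. S \<subseteq> V \<and> indep E S \<and> card S = j}"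

text \<open>The link in the independence complex: V minus the closed neighbourhood of x, not the
  neighbourhood itself.\<close>

definition link :: "'a set set \<Rightarrow> 'a set \<Rightarrow> 'a \<Rightarrow> 'a set" where
  "link E V x = {u \<in> V - {x}. {x, u} \<notin> E}"

lemma indep_subset: "indep E T \<Longrightarrow> S \<subseteq> T \<Longrightarrow> indep E S"
  unfolding indep_def by blast

lemma indep_insert:
  "indep E (insert x S) \<longleftrightarrow> indep E S \<and> (\<forall>u\<in>S. u \<noteq> x \<longrightarrow> {x, u} \<notin> E)"
  unfolding indep_def by (auto simp: insert_commute)

lemma finite_ind: "finite V \<Longrightarrow> finite (ind E V j)"
  unfolding ind_def by (rule finite_subset[of _ "Pow V"]) auto

lemma ind_mono: "V \<subseteq> W \<Longrightarrow> S \<in> ind E V j \<Longrightarrow> S \<in> ind E W j"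
  unfolding ind_def by auto

lemma ind_subset: "T \<in> ind E V l \<Longrightarrow> R \<subseteq> T \<Longrightarrow> card R = j \<Longrightarrow> R \<in> ind E V j"
  unfolding ind_def by (auto intro: indep_subset)

lemma finite_in_ind: "finite V \<Longrightarrow> T \<in> ind E V l \<Longrightarrow> finite T"
  unfolding ind_def by (auto intro: finite_subset)

lemma link_subset: "link E V x \<subseteq> V - {x}"
  unfolding link_def by auto

lemma finite_link: "finite V \<Longrightarrow> finite (link E V x)"
  using link_subset by (rule finite_subset) simp

lemma insert_in_ind:
  assumes "finite V" "x \<in> V" "T \<in> ind E (link E V x) j"
  shows "insert x T \<in> ind E V (Suc j)"
proof -
  have "finite T" "x \<notin> T"
    using finite_in_ind[OF finite_link[OF assms(1)] assms(3)] assms(3) by (auto simp: ind_def link_def)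
  then show ?thesis
    using assms unfolding ind_def link_def by (auto simp: indep_insert)
qed

lemma ind_delete:
  "T \<in> ind E V j \<Longrightarrow> x \<notin> T \<Longrightarrow> T \<in> ind E (V - {x}) j"
  unfolding ind_def by auto

lemma ind_link:
  assumes "finite V" "T \<in> ind E V (Suc j)" "x \<in> T"
  shows "T - {x} \<in> ind E (link E V x) j"
proof -
  have "finite T" using assms finite_in_ind by blast
  then show ?thesis using assms unfolding ind_def link_def indep_def by auto
qed

lemma ind_split:
  assumes "finite V" "x \<in> V"
  shows "ind E V (Suc j) = ind E (V - {x}) (Suc j) \<union> insert x ` ind E (link E V x) j"
proof (intro equalityI subsetI)
  fix T assume T: "T \<in> ind E V (Suc j)"
  show "T \<in> ind E (V - {x}) (Suc j) \<union> insert x ` ind E (link E V x) j"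
  proof (cases "x \<in> T")
    case True
    then have "T = insert x (T - {x})" by auto
    then show ?thesis using ind_link[OF assms(1) T True] by blast
  next
    case False
    then show ?thesis using ind_delete[OF T False] by simp
  qed
next
  fix T assume "T \<in> ind E (V - {x}) (Suc j) \<union> insert x ` ind E (link E V x) j"
  then show "T \<in> ind E V (Suc j)"
  proof
    assume "T \<in> insert x ` ind E (link E V x) j"
    then obtain Q where "Q \<in> ind E (link E V x) j" "T = insert x Q" by blast
    then show ?thesis using insert_in_ind[OF assms, of Q E j] by simp
  next
    assume "T \<in> ind E (V - {x}) (Suc j)"
    then show ?thesis by (rule ind_mono[OF Diff_subset])
  qed
qed

section \<open>Injectivity of powers of the sum of the variables\<close>

definition up :: "('a set \<Rightarrow> 'k::comm_ring_1) \<Rightarrow> nat \<Rightarrow> 'a set \<Rightarrow> 'k" where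
  "up f j T = (\<Sum>R | R \<subseteq> T \<and> card R = j. f R)"

text \<open>Up to the factor k!, the value of up f j at a set T of size j + k is the coefficient at T of the
  product of f with the k-th power of the sum of the variables.\<close>

definition inj_pow :: "'k::comm_ring_1 itself \<Rightarrow> 'a set set \<Rightarrow> 'a set \<Rightarrow> nat \<Rightarrow> nat \<Rightarrow> bool" where
  "inj_pow _ E V j k \<longleftrightarrow> (\<forall>f :: 'a set \<Rightarrow> 'k.
     (\<forall>T\<in>ind E V (j + k). up f j T = 0) \<longrightarrow> (\<forall>S\<in>ind E V j. f S = 0))"

lemma finite_sub_card: "finite T \<Longrightarrow> finite {R. R \<subseteq> T \<and> card R = j}"
  by (rule finite_subset[of _ "Pow T"]) auto

lemma up_insert:
  assumes "finite T" "x \<notin> T"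
  shows "up f (Suc j) (insert x T) = up f (Suc j) T + up (\<lambda>R. f (insert x R)) j T"
proof -
  have eq: "{R. R \<subseteq> insert x T \<and> card R = Suc j}
      = {R. R \<subseteq> T \<and> card R = Suc j} \<union> insert x ` {R. R \<subseteq> T \<and> card R = j}" (is "?A = ?B \<union> insert x ` ?C")
  proof (intro equalityI subsetI)
    fix R assume R: "R \<in> ?A"
    then have fR: "finite R" using assms(1) finite_subset by fastforce
    show "R \<in> ?B \<union> insert x ` ?C"
    proof (cases "x \<in> R")
      case True
      then have "R = insert x (R - {x})" "R - {x} \<in> ?C" using R fR by auto
      then show ?thesis by blast
    qed (use R in auto)
  next
    fix R assume "R \<in> ?B \<union> insert x ` ?C"
    then show "R \<in> ?A"
    proof
      assume "R \<in> insert x ` ?C"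
      then obtain Q where Q: "R = insert x Q" "Q \<subseteq> T" "card Q = j" by auto
      then have "finite Q" "x \<notin> Q" using assms finite_subset by auto
      then show ?thesis using Q by auto
    qed auto
  qed
  have inj: "inj_on (insert x) ?C"
    using assms(2) by (intro inj_onI) (metis (no_types, lifting) insert_ident mem_Collect_eq subset_iff)
  have "up f (Suc j) (insert x T) = sum f ?B + sum f (insert x ` ?C)"
    unfolding up_def eq using assms by (intro sum.union_disjoint) (auto intro: finite_sub_card)
  also have "sum f (insert x ` ?C) = up (\<lambda>R. f (insert x R)) j T"
    unfolding up_def by (simp add: sum.reindex[OF inj] o_def)
  finally show ?thesis by (simp add: up_def)
qed

lemma up_zero_card: "finite T \<Longrightarrow> up f 0 T = f {}"
proof -
  assume "finite T"
  then have "{R. R \<subseteq> T \<and> card R = 0} = {{}}"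
    by (auto dest: finite_subset)
  then show ?thesis by (simp add: up_def)
qed

lemma up_eq_zero:
  assumes "\<And>R. R \<in> ind E V j \<Longrightarrow> f R = 0" "T \<in> ind E V l"
  shows "up f j T = 0"
  unfolding up_def using assms by (intro sum.neutral) (auto intro: ind_subset)

lemma up_diff: "up (\<lambda>R. f R - g R) j T = up f j T - up g j T"
  by (simp add: up_def sum_subtractf)

text \<open>Double count: a j-subset of T survives the deletion of t exactly for the t outside it.
  In terms of the algebra this is one more multiplication by the form, the factor coming from the
  normalisation by k!.\<close>

lemma sum_up_delete:
  assumes "finite T"
  shows "(\<Sum>t\<in>T. up f j (T - {t})) = of_nat (card T - j) * up f j T"
proof -
  have fin: "finite {R. R \<subseteq> T \<and> card R = j}" using assms by (rule finite_sub_card)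
  have "(\<Sum>t\<in>T. up f j (T - {t})) = (\<Sum>t\<in>T. \<Sum>R | R \<subseteq> T \<and> card R = j. if t \<in> R then 0 else f R)"
    unfolding up_def using fin
    by (intro sum.cong refl sum.mono_neutral_cong_left) auto
  also have "\<dots> = (\<Sum>R | R \<subseteq> T \<and> card R = j. \<Sum>t\<in>T. if t \<in> R then 0 else f R)"
    by (rule sum.swap)
  also have "\<dots> = (\<Sum>R | R \<subseteq> T \<and> card R = j. of_nat (card T - j) * f R)"
  proof (intro sum.cong refl)
    fix R assume R: "R \<in> {R. R \<subseteq> T \<and> card R = j}"
    have "(\<Sum>t\<in>T. if t \<in> R then 0 else f R) = (\<Sum>t\<in>T - R. f R)"
      using assms by (intro sum.mono_neutral_cong_right) auto
    also have "\<dots> = of_nat (card (T - R)) * f R" by simp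
    also have "card (T - R) = card T - j"
      using R assms by (metis (mono_tags, lifting) card_Diff_subset finite_subset mem_Collect_eq)
    finally show "(\<Sum>t\<in>T. if t \<in> R then 0 else f R) = of_nat (card T - j) * f R" .
  qed
  finally show ?thesis by (simp add: up_def sum_distrib_left)
qed

lemma inj_pow_0: "inj_pow K E V j 0" if "finite V"
proof -
  have "up f j S = f S" if "S \<in> ind E V j" for f :: "'a set \<Rightarrow> 'b" and S
  proof -
    have "finite S" "card S = j" using that \<open>finite V\<close> by (auto simp: ind_def intro: finite_subset)
    then have "{R. R \<subseteq> S \<and> card R = j} = {S}" by (auto dest: card_subset_eq)
    then show ?thesis by (simp add: up_def)
  qed
  then show ?thesis by (simp add: inj_pow_def)
qed

lemma inj_pow_deg0:
  assumes "finite V" "ind E V k \<noteq> {}"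
  shows "inj_pow K E V 0 k"
proof -
  obtain T where T: "T \<in> ind E V k" using assms by auto
  then have "finite T" using assms finite_in_ind by blast
  moreover have "S = {}" if "S \<in> ind E V 0" for S
    using that assms(1) finite_in_ind[OF assms(1) that] by (auto simp: ind_def)
  ultimately show ?thesis using T by (force simp: inj_pow_def up_zero_card)
qed

lemma inj_pow_empty: "ind E V j = {} \<Longrightarrow> inj_pow K E V j k"
  by (simp add: inj_pow_def)

text \<open>The ideal generated by x is A(link) shifted by one, and the quotient by it is A(G - x).
  A map that is injective on the submodule and on the quotient is injective.\<close>

lemma inj_pow_vertex:
  assumes fin: "finite V" and x: "x \<in> V"
    and 1: "inj_pow K E (V - {x}) (Suc j) k" and 2: "inj_pow K E (link E V x) j k"
  shows "inj_pow (K :: 'k::comm_ring_1 itself) E V (Suc j) k"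
  unfolding inj_pow_def
proof (intro allI impI)
  fix f :: "'a set \<Rightarrow> 'k"
  assume ker: "\<forall>T\<in>ind E V (Suc j + k). up f (Suc j) T = 0"
  have f0: "f S = 0" if "S \<in> ind E (V - {x}) (Suc j)" for S
    using 1 that ker ind_mono[of "V - {x}" V] unfolding inj_pow_def by blast
  have "up (\<lambda>R. f (insert x R)) j T = 0" if T: "T \<in> ind E (link E V x) (j + k)" for T
  proof -
    have "T \<in> ind E (V - {x}) (j + k)" by (rule ind_mono[OF link_subset T])
    then have "up f (Suc j) T = 0" using f0 by (rule up_eq_zero[rotated])
    moreover have "insert x T \<in> ind E V (Suc j + k)"
      using insert_in_ind[OF fin x T] by simp
    moreover have "finite T" "x \<notin> T"
      using finite_in_ind[OF finite_link[OF fin] T] T by (auto simp: ind_def link_def)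
    ultimately show ?thesis using ker up_insert[of T x f j] by simp
  qed
  then have f1: "f (insert x S) = 0" if "S \<in> ind E (link E V x) j" for S
    using 2 that unfolding inj_pow_def by blast
  show "\<forall>S\<in>ind E V (Suc j). f S = 0"
    unfolding ind_split[OF fin x] using f0 f1 by auto
qed

text \<open>A leaf v with neighbour w in the graph induced on V, expressed by links: V' is V - N[v]
  and V'' is V - N[w]. The edge set E stays fixed while V shrinks.\<close>

locale leaf =
  fixes E :: "'a set set" and V V' V'' :: "'a set" and v w :: 'a
  assumes fin: "finite V" and v: "v \<in> V" and w: "w \<in> V" and vw: "v \<noteq> w"
    and lv: "link E V v = V'" and lw: "link E V w = V''"
    and V': "V' = V - {v, w}" and V'': "V'' \<subseteq> V'"
begin

lemma finV': "finite V'" and finV'': "finite V''"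
  using fin V' V'' finite_subset by auto

text \<open>The double count below is the Clebsch-Gordan rule for the tensor product with k[t]/(t^2).\<close>

lemma inj_pow_leaf:
  fixes K :: "'k::field_char_0 itself"
  assumes 1: "inj_pow K E V' j (Suc (Suc k))" and 2: "inj_pow K E V' (Suc j) k"
    and 3: "inj_pow K E V'' j (Suc k)"
  shows "inj_pow K E V (Suc j) (Suc k)"
  unfolding inj_pow_def
proof (intro allI impI)
  fix f :: "'a set \<Rightarrow> 'k"
  assume "\<forall>T\<in>ind E V (Suc j + Suc k). up f (Suc j) T = 0"
  then have ker: "\<And>T. T \<in> ind E V (Suc (Suc (j + k))) \<Longrightarrow> up f (Suc j) T = 0" by simp
  define fv where "fv R = f (insert v R)" for R
  define fw where "fw R = f (insert w R)" for R
  have V'V: "V' \<subseteq> V" using V' by auto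
  have e0: "up f (Suc j) T = 0" if "T \<in> ind E V' (Suc (Suc (j + k)))" for T
    using ker that ind_mono[OF V'V] by blast
  have ev: "up f (Suc j) T + up fv j T = 0" if T: "T \<in> ind E V' (Suc (j + k))" for T
  proof -
    have "finite T" "v \<notin> T" using finite_in_ind[OF finV' T] T V' by (auto simp: ind_def)
    then show ?thesis
      using ker[OF insert_in_ind[OF fin v]] T up_insert[of T v f j] unfolding lv fv_def by simp
  qed
  have ew: "up f (Suc j) T + up fw j T = 0" if T: "T \<in> ind E V'' (Suc (j + k))" for T
  proof -
    have "finite T" "w \<notin> T" using finite_in_ind[OF finV' ind_mono[OF V'' T]] T V' V''
      by (auto simp: ind_def)
    then show ?thesis
      using ker[OF insert_in_ind[OF fin w]] T up_insert[of T w f j] unfolding lw fw_def by simp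
  qed
  \<comment> \<open>\<open>fw - fv\<close> on V'' is the projection of f to the summand A(G - N[w])
    shifted by one. Subtracting the two equations eliminates the part of f without v and w.\<close>
  have "up (\<lambda>R. fw R - fv R) j T = 0" if "T \<in> ind E V'' (j + Suc k)" for T
    using ew[of T] ev[of T] that ind_mono[OF V''] unfolding up_diff
    by (metis add_Suc_right add_left_cancel diff_self)
  then have fwv: "fw S = fv S" if "S \<in> ind E V'' j" for S
    using 3 that unfolding inj_pow_def by (metis (no_types, lifting) eq_iff_diff_eq_0)
  \<comment> \<open>The equations \<open>ev\<close> are summed over all T - {t}. The part of f
    without v and w drops out by \<open>e0\<close>, and the factor k + 2 in front of the rest is
    invertible.\<close>
  have "up fv j T = 0" if T: "T \<in> ind E V' (j + Suc (Suc k))" for T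
  proof -
    have fT: "finite T" and cT: "card T = Suc (Suc (j + k))"
      using T finV' finite_in_ind by (auto simp: ind_def)
    have "T - {t} \<in> ind E V' (Suc (j + k))" if "t \<in> T" for t
      using T that cT fT by (intro ind_subset[OF T]) auto
    then have "0 = (\<Sum>t\<in>T. up f (Suc j) (T - {t}) + up fv j (T - {t}))"
      using ev by simp
    also have "\<dots> = of_nat (card T - Suc j) * up f (Suc j) T + of_nat (card T - j) * up fv j T"
      by (simp only: sum.distrib sum_up_delete[OF fT])
    also have "up f (Suc j) T = 0" using e0 T by simp
    finally have "of_nat (card T - j) * up fv j T = 0" by simp
    moreover have "card T - j \<noteq> 0" using cT by simp
    ultimately show ?thesis by (metis mult_eq_0_iff of_nat_eq_0_iff)
  qed
  then have fv0: "fv S = 0" if "S \<in> ind E V' j" for S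
    using 1 that unfolding inj_pow_def by blast
  have "up f (Suc j) T = 0" if "T \<in> ind E V' (Suc j + k)" for T
    using ev[of T] up_eq_zero[of E V' j fv T] fv0 that by auto
  then have f0: "f S = 0" if "S \<in> ind E V' (Suc j)" for S
    using 2 that unfolding inj_pow_def by blast
  show "\<forall>S\<in>ind E V (Suc j). f S = 0"
  proof
    fix S assume S: "S \<in> ind E V (Suc j)"
    consider "v \<in> S" | "v \<notin> S" "w \<in> S" | "v \<notin> S" "w \<notin> S" by blast
    then show "f S = 0"
    proof cases
      case 1
      then have "fv (S - {v}) = 0" using ind_link[OF fin S] fv0 lv by auto
      then show ?thesis using 1 by (simp add: fv_def insert_absorb)
    next
      case 2
      then have *: "S - {w} \<in> ind E V'' j" using ind_link[OF fin S] lw by auto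
      then have "fw (S - {w}) = 0" using fwv fv0 ind_mono[OF V''] by metis
      then show ?thesis using 2 by (simp add: fw_def insert_absorb)
    next
      case 3
      then have "S \<in> ind E V' (Suc j)" using S V' by (auto simp: ind_def)
      then show ?thesis by (rule f0)
    qed
  qed
qed

end

section \<open>Surjectivity, in dual form\<close>

text \<open>The transpose of \<open>up\<close>. Independence is built in here because supersets of
  an independent set need not be independent, whereas subsets always are.\<close>

definition dn :: "'a set set \<Rightarrow> 'a set \<Rightarrow> ('a set \<Rightarrow> 'k::comm_ring_1) \<Rightarrow> nat \<Rightarrow> 'a set \<Rightarrow> 'k" where
  "dn E V f j S = (\<Sum>T | T \<in> ind E V j \<and> S \<subseteq> T. f T)"

text \<open>S ranges over all sets of cardinality i. If S is dependent or not contained in V, the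
  sum is empty, so the condition is the same as for independent S.\<close>

definition ker_dn :: "'a set set \<Rightarrow> 'a set \<Rightarrow> ('a set \<Rightarrow> 'k::comm_ring_1) \<Rightarrow> nat \<Rightarrow> nat \<Rightarrow> bool" where
  "ker_dn E V f i j \<longleftrightarrow> (\<forall>S. card S = i \<longrightarrow> dn E V f j S = 0)"

text \<open>Surjectivity of the k-th power from degree i to degree i + k, expressed as injectivity of the
  transposed map.\<close>

definition sur_pow :: "'k::comm_ring_1 itself \<Rightarrow> 'a set set \<Rightarrow> 'a set \<Rightarrow> nat \<Rightarrow> nat \<Rightarrow> bool" where
  "sur_pow _ E V i k \<longleftrightarrow>
     (\<forall>f :: 'a set \<Rightarrow> 'k. ker_dn E V f i (i + k) \<longrightarrow> (\<forall>T\<in>ind E V (i + k). f T = 0))"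

lemma ker_dnD: "ker_dn E V f i j \<Longrightarrow> card S = i \<Longrightarrow> dn E V f j S = 0"
  by (simp add: ker_dn_def)

lemma sur_powD:
  fixes f :: "'a set \<Rightarrow> 'k::comm_ring_1"
  shows "sur_pow (K :: 'k itself) E V i k \<Longrightarrow> ker_dn E V f i j \<Longrightarrow> j = i + k \<Longrightarrow> T \<in> ind E V j \<Longrightarrow> f T = 0"
  by (simp add: sur_pow_def)

lemma finite_above: "finite V \<Longrightarrow> finite {T. T \<in> ind E V j \<and> S \<subseteq> T}"
  by (rule finite_subset[OF _ finite_ind]) auto

lemma dn_not_subset: "\<not> S \<subseteq> V \<Longrightarrow> dn E V f j S = 0"
proof -
  assume "\<not> S \<subseteq> V"
  then have "{T. T \<in> ind E V j \<and> S \<subseteq> T} = {}" by (auto simp: ind_def)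
  then show ?thesis unfolding dn_def by (simp only: sum.empty)
qed

lemma dn_eq_zero: "(\<And>T. T \<in> ind E V j \<Longrightarrow> f T = 0) \<Longrightarrow> dn E V f j S = 0"
  unfolding dn_def by (intro sum.neutral) auto

lemma inj_on_insert: "inj_on (insert x) {T \<in> A. x \<notin> T}"
  by (intro inj_onI) (metis (mono_tags, lifting) insert_ident mem_Collect_eq)

lemma not_in_link: "T \<in> ind E (link E V x) j \<Longrightarrow> x \<notin> T"
  by (auto simp: ind_def link_def)

lemma dn_split:
  assumes "finite V" "x \<in> V" "x \<notin> S"
  shows "dn E V f (Suc j) S
    = dn E (V - {x}) f (Suc j) S + dn E (link E V x) (\<lambda>R. f (insert x R)) j S"
proof -
  let ?A = "{T. T \<in> ind E (V - {x}) (Suc j) \<and> S \<subseteq> T}"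
  let ?B = "{T. T \<in> ind E (link E V x) j \<and> S \<subseteq> T}"
  have eq: "{T. T \<in> ind E V (Suc j) \<and> S \<subseteq> T} = ?A \<union> insert x ` ?B"
    unfolding ind_split[OF assms(1,2)] using assms(3) by auto
  have inj: "inj_on (insert x) ?B"
    by (rule inj_on_subset[OF inj_on_insert[of x UNIV]]) (auto dest: not_in_link)
  have "dn E V f (Suc j) S = sum f ?A + sum f (insert x ` ?B)"
    unfolding dn_def eq using assms(1)
    by (intro sum.union_disjoint finite_imageI finite_above finite_link finite_Diff)
      (auto simp: ind_def)
  also have "sum f (insert x ` ?B) = dn E (link E V x) (\<lambda>R. f (insert x R)) j S"
    unfolding dn_def by (simp add: sum.reindex[OF inj] o_def)
  finally show ?thesis by (simp add: dn_def)
qed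

lemma dn_insert:
  assumes "finite V" "x \<in> V" "x \<notin> S"
  shows "dn E V f (Suc j) (insert x S) = dn E (link E V x) (\<lambda>R. f (insert x R)) j S"
proof -
  let ?B = "{T. T \<in> ind E (link E V x) j \<and> S \<subseteq> T}"
  have eq: "{T. T \<in> ind E V (Suc j) \<and> insert x S \<subseteq> T} = insert x ` ?B"
    unfolding ind_split[OF assms(1,2)] using assms(3) by (auto simp: ind_def)
  have inj: "inj_on (insert x) ?B"
    by (rule inj_on_subset[OF inj_on_insert[of x UNIV]]) (auto dest: not_in_link)
  show ?thesis unfolding dn_def eq by (simp add: sum.reindex[OF inj] o_def)
qed

text \<open>Dual of \<open>sum_up_delete\<close>: a set T above S is counted once for each element
  of T - S.\<close>

lemma sum_dn_insert:
  assumes "finite V" "finite S" "S \<subseteq> V"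
  shows "(\<Sum>y\<in>V - S. dn E V f j (insert y S)) = of_nat (j - card S) * dn E V f j S"
proof -
  let ?A = "{T. T \<in> ind E V j \<and> S \<subseteq> T}"
  have fin: "finite ?A" using assms(1) by (rule finite_above)
  have "(\<Sum>y\<in>V - S. dn E V f j (insert y S)) = (\<Sum>y\<in>V - S. \<Sum>T\<in>?A. if y \<in> T then f T else 0)"
    unfolding dn_def using fin by (intro sum.cong refl sum.mono_neutral_cong_left) auto
  also have "\<dots> = (\<Sum>T\<in>?A. \<Sum>y\<in>V - S. if y \<in> T then f T else 0)"
    by (rule sum.swap)
  also have "\<dots> = (\<Sum>T\<in>?A. of_nat (j - card S) * f T)"
  proof (intro sum.cong refl)
    fix T assume T: "T \<in> ?A"
    have "(\<Sum>y\<in>V - S. if y \<in> T then f T else 0) = (\<Sum>y\<in>T - S. f T)"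
      using assms T by (intro sum.mono_neutral_cong_right) (auto simp: ind_def)
    also have "\<dots> = of_nat (card (T - S)) * f T" by simp
    also have "card (T - S) = j - card S"
      using T assms(2) by (simp add: ind_def card_Diff_subset)
    finally show "(\<Sum>y\<in>V - S. if y \<in> T then f T else 0) = of_nat (j - card S) * f T" .
  qed
  finally show ?thesis by (simp add: dn_def sum_distrib_left)
qed

text \<open>Restriction of the functional f to the ideal generated by x, which is A(link) shifted by
  one.\<close>

lemma ker_dn_link:
  assumes "finite V" "x \<in> V" "ker_dn E V f (Suc i) (Suc j)"
  shows "ker_dn E (link E V x) (\<lambda>R. f (insert x R)) i j"
  unfolding ker_dn_def
proof (intro allI impI)
  fix S :: "'a set" assume S: "card S = i"
  show "dn E (link E V x) (\<lambda>R. f (insert x R)) j S = 0"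
  proof (cases "S \<subseteq> link E V x")
    case True
    then have "x \<notin> S" "finite S"
      using finite_link[OF assms(1)] by (auto simp: link_def intro: finite_subset)
    then show ?thesis
      using dn_insert[OF assms(1,2), of S E f j] ker_dnD[OF assms(3), of "insert x S"] S by simp
  qed (rule dn_not_subset)
qed

text \<open>A functional that vanishes on the ideal generated by x descends to the quotient A(G -
  x).\<close>

lemma ker_dn_delete:
  assumes "finite V" "x \<in> V" "ker_dn E V f i (Suc j)"
    and 0: "\<And>T. T \<in> ind E (link E V x) j \<Longrightarrow> f (insert x T) = 0"
  shows "ker_dn E (V - {x}) f i (Suc j)"
  unfolding ker_dn_def
proof (intro allI impI)
  fix S :: "'a set" assume S: "card S = i"
  show "dn E (V - {x}) f (Suc j) S = 0"
  proof (cases "x \<in> S")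
    case False
    then show ?thesis
      using dn_split[OF assms(1,2) False, of E f j] ker_dnD[OF assms(3) S]
        dn_eq_zero[of E "link E V x" j "\<lambda>R. f (insert x R)" S] 0 by simp
  qed (auto intro: dn_not_subset)
qed

lemma sur_pow_0: "sur_pow K E V i 0" if "finite V"
  unfolding sur_pow_def
proof (intro allI impI ballI)
  fix f :: "'a set \<Rightarrow> 'b" and T assume ker: "ker_dn E V f i (i + 0)" and T: "T \<in> ind E V (i + 0)"
  have "R = T" if "R \<in> ind E V i" "T \<subseteq> R" for R
    using card_subset_eq[OF finite_in_ind[OF \<open>finite V\<close> that(1)] that(2)] that T by (simp add: ind_def)
  then have "{R. R \<in> ind E V i \<and> T \<subseteq> R} = {T}" using T by auto
  then have "dn E V f i T = f T" by (simp add: dn_def)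
  then show "f T = 0" using ker T by (auto simp: ker_dn_def ind_def)
qed

lemma sur_pow_empty: "ind E V (i + k) = {} \<Longrightarrow> sur_pow K E V i k"
  by (simp add: sur_pow_def)

lemma sur_pow_deg0:
  assumes "\<And>T T'. T \<in> ind E V k \<Longrightarrow> T' \<in> ind E V k \<Longrightarrow> T = T'"
  shows "sur_pow (K :: 'k::comm_ring_1 itself) E V 0 k"
  unfolding sur_pow_def
proof (intro allI impI ballI)
  fix f :: "'a set \<Rightarrow> 'k" and T assume ker: "ker_dn E V f 0 (0 + k)" and T: "T \<in> ind E V (0 + k)"
  then have "{R. R \<in> ind E V k \<and> {} \<subseteq> R} = {T}" using assms by auto
  then have "dn E V f k {} = f T" by (simp add: dn_def)
  then show "f T = 0" using ker by (auto simp: ker_dn_def)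
qed

lemma sur_pow_vertex:
  assumes fin: "finite V" and x: "x \<in> V"
    and 1: "sur_pow K E (V - {x}) (Suc i) k" and 2: "sur_pow K E (link E V x) i k"
  shows "sur_pow (K :: 'k::comm_ring_1 itself) E V (Suc i) k"
  unfolding sur_pow_def
proof (intro allI impI)
  fix f :: "'a set \<Rightarrow> 'k"
  assume "ker_dn E V f (Suc i) (Suc i + k)"
  then have ker: "ker_dn E V f (Suc i) (Suc (i + k))" by simp
  have f1: "f (insert x T) = 0" if "T \<in> ind E (link E V x) (i + k)" for T
    using sur_powD[OF 2 ker_dn_link[OF fin x ker] refl that] .
  have "f T = 0" if "T \<in> ind E (V - {x}) (Suc (i + k))" for T
    using sur_powD[OF 1 ker_dn_delete[OF fin x ker f1] _ that] by simp
  with f1 show "\<forall>T\<in>ind E V (Suc i + k). f T = 0"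
    using ind_split[OF fin x, of E "i + k"] by auto
qed

text \<open>This holds because the algebra is generated in degree one.\<close>

lemma sur_pow_Suc:
  assumes fin: "finite V" and s: "sur_pow K E V i k"
  shows "sur_pow (K :: 'k::comm_ring_1 itself) E V (Suc i) k"
  unfolding sur_pow_def
proof (intro allI impI ballI)
  fix f :: "'a set \<Rightarrow> 'k" and T
  assume "ker_dn E V f (Suc i) (Suc i + k)" and "T \<in> ind E V (Suc i + k)"
  then have ker: "ker_dn E V f (Suc i) (Suc (i + k))" and T: "T \<in> ind E V (Suc (i + k))"
    by simp_all
  from T obtain x where x: "x \<in> T" by (fastforce simp: ind_def)
  then have xV: "x \<in> V" using T by (auto simp: ind_def)
  have sub: "link E V x \<subseteq> V" using link_subset[of E V x] by blast
  \<comment> \<open>Extension by zero: the contraction by x lives on the link, while the hypothesis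
    \<open>s\<close> concerns V.\<close>
  define g where "g R = (if R \<in> ind E (link E V x) (i + k) then f (insert x R) else 0)" for R
  have "dn E V g (i + k) S = dn E (link E V x) (\<lambda>R. f (insert x R)) (i + k) S" for S
    unfolding dn_def g_def using finite_above[OF fin] ind_mono[OF sub]
    by (intro sum.mono_neutral_cong_right) auto
  then have "ker_dn E V g i (i + k)"
    using ker_dn_link[OF fin xV ker] by (simp add: ker_dn_def)
  moreover have R: "T - {x} \<in> ind E (link E V x) (i + k)" by (rule ind_link[OF fin T x])
  moreover have "T - {x} \<in> ind E V (i + k)"
    by (rule ind_mono[OF sub R])
  ultimately have "g (T - {x}) = 0" using s unfolding sur_pow_def by blast
  then show "f T = 0" using R x by (simp add: g_def insert_absorb)
qed

lemma sur_pow_mono: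
  assumes "finite V" "sur_pow K E V i k" "i \<le> i'"
  shows "sur_pow (K :: 'k::comm_ring_1 itself) E V i' k"
  using assms(3)
proof (induction rule: dec_induct)
  case (step n)
  then show ?case by (intro sur_pow_Suc[OF assms(1)])
qed (rule assms(2))

section \<open>Removing a leaf: surjectivity in dual form\<close>

context leaf
begin

lemma link_delete: "link E (V - {v}) w = V''"
  using lw V'' V' unfolding link_def by auto

lemma leaf_dn:
  fixes f :: "'a set \<Rightarrow> 'k::comm_ring_1"
  assumes ker: "ker_dn E V f (Suc i) (Suc l)" and S: "card S = Suc i" "v \<notin> S" "w \<notin> S"
  shows "dn E V' f (Suc l) S + dn E V'' (\<lambda>R. f (insert w R)) l S
    + dn E V' (\<lambda>R. f (insert v R)) l S = 0"
proof -
  have "dn E V f (Suc l) S = 0" using ker_dnD[OF ker S(1)] .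
  moreover have "V - {v} - {w} = V'" using V' by auto
  ultimately show ?thesis
    using dn_split[OF fin v S(2), of E f l] dn_split[of "V - {v}" w S E f l] fin w vw S(3)
    by (simp add: link_delete lv)
qed

text \<open>Summing \<open>leaf_dn\<close> at \<open>insert y S\<close> over y in V' - S, with S of
  size i, turns each of its terms into a multiple of the contraction at S. The terms for v and w
  vanish by \<open>ker_dn_link\<close>. The factor k + 2 of the remaining one is invertible, so f on
  V' is in the kernel of the transpose of the power k + 2.\<close>

lemma leaf_avoid:
  fixes f :: "'a set \<Rightarrow> 'k::field_char_0"
  assumes ker: "ker_dn E V f (Suc i) (Suc (Suc (i + k)))"
    and sur: "sur_pow TYPE('k) E V' i (Suc (Suc k))" and T: "T \<in> ind E V' (Suc (Suc (i + k)))"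
  shows "f T = 0"
proof -
  let ?l = "Suc (i + k)"
  let ?fv = "\<lambda>R. f (insert v R)" and ?fw = "\<lambda>R. f (insert w R)"
  have kv: "ker_dn E V' ?fv i ?l" using ker_dn_link[OF fin v ker] lv by simp
  have kw: "ker_dn E V'' ?fw i ?l" using ker_dn_link[OF fin w ker] lw by simp
  have "dn E V' f (Suc ?l) S = 0" if S: "card S = i" for S
  proof (cases "S \<subseteq> V'")
    case True
    then have fS: "finite S" using finV' finite_subset by blast
    have "dn E V' f (Suc ?l) (insert y S) + dn E V'' ?fw ?l (insert y S) + dn E V' ?fv ?l (insert y S) = 0"
      if y: "y \<in> V' - S" for y
      using y True fS S V' by (intro leaf_dn[OF ker]) auto
    then have "0 = (\<Sum>y\<in>V' - S. dn E V' f (Suc ?l) (insert y S) + dn E V'' ?fw ?l (insert y S)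
        + dn E V' ?fv ?l (insert y S))"
      by simp
    also have "\<dots> = of_nat (Suc ?l - i) * dn E V' f (Suc ?l) S
        + (\<Sum>y\<in>V' - S. dn E V'' ?fw ?l (insert y S)) + of_nat (?l - i) * dn E V' ?fv ?l S"
      by (simp only: sum.distrib sum_dn_insert[OF finV' fS True] S)
    also have "dn E V' ?fv ?l S = 0" using kv S by (rule ker_dnD)
    also have "(\<Sum>y\<in>V' - S. dn E V'' ?fw ?l (insert y S)) = 0"
    proof (cases "S \<subseteq> V''")
      case S'': True
      have "(\<Sum>y\<in>V' - S. dn E V'' ?fw ?l (insert y S)) = (\<Sum>y\<in>V'' - S. dn E V'' ?fw ?l (insert y S))"
        using V'' finV' by (intro sum.mono_neutral_right) (auto intro: dn_not_subset)
      also have "\<dots> = of_nat (?l - i) * dn E V'' ?fw ?l S"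
        by (simp only: sum_dn_insert[OF finV'' fS S''] S)
      also have "dn E V'' ?fw ?l S = 0" using kw S by (rule ker_dnD)
      finally show ?thesis by simp
    qed (auto intro!: sum.neutral dn_not_subset)
    finally have "of_nat (Suc ?l - i) * dn E V' f (Suc ?l) S = 0" by simp
    moreover have "Suc ?l - i \<noteq> 0" by simp
    ultimately show ?thesis by (metis mult_eq_0_iff of_nat_eq_0_iff)
  qed (rule dn_not_subset)
  then have k0: "ker_dn E V' f i (Suc ?l)" by (simp add: ker_dn_def)
  show ?thesis by (rule sur_powD[OF sur k0 _ T]) simp
qed

text \<open>Once f vanishes on the sets inside V', \<open>leaf_dn\<close> loses its first term. For
  k = 0 both sums are single values, which is the source of the antisymmetry in
  \<open>peel_left\<close>.\<close>

lemma leaf_swap: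
  fixes f :: "'a set \<Rightarrow> 'k::field_char_0"
  assumes ker: "ker_dn E V f (Suc i) (Suc (Suc (i + k)))"
    and sur: "sur_pow TYPE('k) E V' i (Suc (Suc k))" and S: "card S = Suc i"
  shows "dn E V'' (\<lambda>R. f (insert w R)) (Suc (i + k)) S + dn E V' (\<lambda>R. f (insert v R)) (Suc (i + k)) S = 0"
proof (cases "S \<subseteq> V'")
  case True
  have "dn E V' f (Suc (Suc (i + k))) S = 0"
    by (rule dn_eq_zero) (rule leaf_avoid[OF ker sur])
  then show ?thesis using leaf_dn[OF ker S] True V' by auto
next
  case False
  then have "\<not> S \<subseteq> V''" using V'' by auto
  with False show ?thesis by (simp add: dn_not_subset)
qed

text \<open>The Clebsch-Gordan rule for the transpose. The first hypothesis kills f on sets avoiding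
  v and w, the third on sets through w; then \<open>leaf_swap\<close> puts the contraction by v into
  the kernel treated by the second.\<close>

lemma sur_pow_leaf:
  assumes 1: "sur_pow TYPE('k::field_char_0) E V' i (Suc (Suc k))" and 2: "sur_pow TYPE('k) E V' (Suc i) k"
    and 3: "sur_pow TYPE('k) E V'' i (Suc k)"
  shows "sur_pow TYPE('k) E V (Suc i) (Suc k)"
  unfolding sur_pow_def
proof (intro allI impI ballI)
  fix f :: "'a set \<Rightarrow> 'k" and T
  assume "ker_dn E V f (Suc i) (Suc i + Suc k)" and "T \<in> ind E V (Suc i + Suc k)"
  then have ker: "ker_dn E V f (Suc i) (Suc (Suc (i + k)))" and T: "T \<in> ind E V (Suc (Suc (i + k)))"
    by simp_all
  let ?l = "Suc (i + k)"
  let ?fv = "\<lambda>R. f (insert v R)" and ?fw = "\<lambda>R. f (insert w R)"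
  have kw: "ker_dn E V'' ?fw i ?l" using ker_dn_link[OF fin w ker] lw by simp
  have fw: "?fw R = 0" if "R \<in> ind E V'' ?l" for R
    by (rule sur_powD[OF 3 kw _ that]) simp
  have kv: "ker_dn E V' ?fv (Suc i) ?l"
    using leaf_swap[OF ker 1] dn_eq_zero[of E V'' ?l ?fw] fw by (simp add: ker_dn_def)
  have fv: "?fv R = 0" if "R \<in> ind E V' ?l" for R
    by (rule sur_powD[OF 2 kv _ that]) simp
  consider "v \<in> T" | "v \<notin> T" "w \<in> T" | "v \<notin> T" "w \<notin> T" by blast
  then show "f T = 0"
  proof cases
    case 1
    then show ?thesis using fv[of "T - {v}"] ind_link[OF fin T, of v] lv by (simp add: insert_absorb)
  next
    case 2
    then show ?thesis using fw[of "T - {w}"] ind_link[OF fin T, of w] lw by (simp add: insert_absorb)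
  next
    case 3
    then have "T \<in> ind E V' (Suc ?l)" using T V' by (auto simp: ind_def)
    then show ?thesis by (rule leaf_avoid[OF ker 1])
  qed
qed

end

section \<open>Paths\<close>

text \<open>Only edges inside the interval are prescribed, so subpaths of the tadpole can be treated
  with its full edge set.\<close>

definition pathlike :: "nat set set \<Rightarrow> nat \<Rightarrow> nat \<Rightarrow> bool" where
  "pathlike E a b \<longleftrightarrow> (\<forall>u\<in>{a..<b}. \<forall>v\<in>{a..<b}. {u, v} \<in> E \<longleftrightarrow> v = Suc u \<or> u = Suc v)"

lemma pathlike_mono: "pathlike E a b \<Longrightarrow> a \<le> a' \<Longrightarrow> b' \<le> b \<Longrightarrow> pathlike E a' b'"
  unfolding pathlike_def by auto

lemma leaf_right:
  assumes "pathlike E a (Suc (Suc b))" "a \<le> b"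
  shows "leaf E {a..<Suc (Suc b)} {a..<b} {a..<b - 1} (Suc b) b"
proof
  show "link E {a..<Suc (Suc b)} (Suc b) = {a..<b}"
    using assms unfolding link_def pathlike_def by auto
  show "link E {a..<Suc (Suc b)} b = {a..<b - 1}"
    using assms unfolding link_def pathlike_def by force
  show "{a..<b - 1} \<subseteq> {a..<b}" by (rule ivl_subset[THEN iffD2]) simp
qed (use assms in auto)

lemma leaf_left:
  assumes "pathlike E a b" "Suc (Suc a) \<le> b"
  shows "leaf E {a..<b} {Suc (Suc a)..<b} {Suc (Suc (Suc a))..<b} a (Suc a)"
proof
  show "link E {a..<b} a = {Suc (Suc a)..<b}"
    using assms unfolding link_def pathlike_def by auto
  show "link E {a..<b} (Suc a) = {Suc (Suc (Suc a))..<b}"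
    using assms unfolding link_def pathlike_def by auto
qed (use assms in auto)

lemma path_ind_nonempty:
  assumes p: "pathlike E a (a + n)" and k: "2 * k \<le> Suc n"
  shows "ind E {a..<a + n} k \<noteq> {}"
proof -
  let ?T = "(\<lambda>i. a + 2 * i) ` {..<k}"
  have "inj_on (\<lambda>i. a + 2 * i) {..<k}" by (auto intro: inj_onI)
  then have "card ?T = k" by (simp add: card_image)
  moreover have sub: "?T \<subseteq> {a..<a + n}" using k by auto
  moreover have "indep E ?T"
    unfolding indep_def
  proof (intro ballI impI)
    fix u v assume uv: "u \<in> ?T" "v \<in> ?T"
    then have "{u, v} \<in> E \<longleftrightarrow> v = Suc u \<or> u = Suc v"
      using sub p unfolding pathlike_def by blast
    moreover have "\<not> (v = Suc u \<or> u = Suc v)" using uv by auto presburger+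
    ultimately show "{u, v} \<notin> E" by simp
  qed
  ultimately have "?T \<in> ind E {a..<a + n} k" by (simp add: ind_def)
  then show ?thesis by blast
qed

text \<open>An independent set and its shift are disjoint, so a set attaining the maximal size together with
  its shift tiles the interval.\<close>

lemma path_ind_unique:
  assumes p: "pathlike E a (a + n)" and k: "Suc n \<le> 2 * k"
    and T: "T \<in> ind E {a..<a + n} k" and T': "T' \<in> ind E {a..<a + n} k"
  shows "T = T'"
proof -
  have tile: "x \<in> S \<longleftrightarrow> x \<notin> Suc ` S" 
    if S: "S \<in> ind E {a..<a + n} k" and x: "x \<in> {a..<Suc (a + n)}" for S x
  proof -
    have fin: "finite S" and sub: "S \<subseteq> {a..<a + n}" and card: "card S = k" and st: "indep E S"
      using S by (auto simp: ind_def intro: finite_subset)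
    have disj: "S \<inter> Suc ` S = {}"
    proof (rule ccontr)
      assume "S \<inter> Suc ` S \<noteq> {}"
      then obtain u where u: "u \<in> S" "Suc u \<in> S" by auto
      then have "{u, Suc u} \<in> E" using p sub unfolding pathlike_def by blast
      then show False using st u unfolding indep_def by (metis n_not_Suc_n)
    qed
    have "card (S \<union> Suc ` S) = 2 * k"
      using disj fin card by (simp add: card_Un_disjoint card_image)
    moreover have "S \<union> Suc ` S \<subseteq> {a..<Suc (a + n)}" using sub by auto
    ultimately have "S \<union> Suc ` S = {a..<Suc (a + n)}"
      using k by (intro card_seteq) auto
    then show ?thesis using x disj by blast
  qed
  have "x \<in> T \<longleftrightarrow> x \<in> T'" if "a \<le> x" "x < Suc (a + n)" for x
    using that
  proof (induction rule: dec_induct)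
    case base
    have "a \<notin> Suc ` T" "a \<notin> Suc ` T'" using T T' by (auto simp: ind_def)
    then show ?case using tile[OF T, of a] tile[OF T', of a] by auto
  next
    case (step y)
    then show ?case using tile[OF T, of "Suc y"] tile[OF T', of "Suc y"] by auto
  qed
  moreover have "T \<subseteq> {a..<a + n}" "T' \<subseteq> {a..<a + n}" using T T' by (auto simp: ind_def)
  ultimately show ?thesis by (auto simp: subset_iff)
qed

text \<open>The recursion of \<open>inj_pow_leaf\<close> as a test on degree, number of vertices and
  power. In degree 0 the power of the form must be nonzero, so an independent k-set must exist. A
  single vertex fails only in degree 1, where a nonzero component is mapped to zero. The truncated
  \<open>n - 1\<close> stands for the empty V'' when V' is empty.\<close>

fun path_inj :: "nat \<Rightarrow> nat \<Rightarrow> nat \<Rightarrow> bool" where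
  "path_inj 0 n k = (2 * k \<le> Suc n)"
| "path_inj (Suc j) n 0 = True"
| "path_inj (Suc j) 0 (Suc k) = True"
| "path_inj (Suc j) (Suc 0) (Suc k) = (j > 0)"
| "path_inj (Suc j) (Suc (Suc n)) (Suc k) =
    (path_inj j n (Suc (Suc k)) \<and> path_inj (Suc j) n k \<and> path_inj j (n - 1) (Suc k))"

text \<open>From degree 0 a positive power is onto as soon as there is at most one independent
  k-set, hence \<open>Suc n \<le> 2 * k\<close>. With at most one vertex the target degree is at
  least 2, so the target is zero.\<close>

fun path_sur :: "nat \<Rightarrow> nat \<Rightarrow> nat \<Rightarrow> bool" where
  "path_sur 0 n k = (k = 0 \<or> Suc n \<le> 2 * k)"
| "path_sur (Suc i) n 0 = True"
| "path_sur (Suc i) 0 (Suc k) = True"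
| "path_sur (Suc i) (Suc 0) (Suc k) = True"
| "path_sur (Suc i) (Suc (Suc n)) (Suc k) =
    (path_sur i n (Suc (Suc k)) \<and> path_sur (Suc i) n k \<and> path_sur i (n - 1) (Suc k))"

lemma ind_card_le: "finite V \<Longrightarrow> T \<in> ind E V j \<Longrightarrow> j \<le> card V"
  unfolding ind_def by (auto intro: card_mono)

lemma ind_empty_if: "finite V \<Longrightarrow> card V < j \<Longrightarrow> ind E V j = {}"
  using ind_card_le by fastforce

lemma path_inj_pow:
  assumes "path_inj j n k" "pathlike E a (a + n)"
  shows "inj_pow TYPE('k::field_char_0) E {a..<a + n} j k"
  using assms
proof (induction j n k rule: path_inj.induct)
  case (1 n k)
  then show ?case by (intro inj_pow_deg0 path_ind_nonempty) auto
next
  case (2 j n)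
  show ?case by (rule inj_pow_0) simp
next
  case (3 j k)
  show ?case by (intro inj_pow_empty ind_empty_if) auto
next
  case (4 j k)
  then show ?case by (intro inj_pow_empty ind_empty_if) auto
next
  case (5 j n k)
  interpret leaf E "{a..<Suc (Suc (a + n))}" "{a..<a + n}" "{a..<a + n - 1}" "Suc (a + n)" "a + n"
    using 5 by (intro leaf_right) auto
  have eq: "{a..<a + n - 1} = {a..<a + (n - 1)}" by auto
  have "inj_pow TYPE('k) E {a..<a + n} j (Suc (Suc k))" "inj_pow TYPE('k) E {a..<a + n} (Suc j) k"
    "inj_pow TYPE('k) E {a..<a + (n - 1)} j (Suc k)"
    using 5 pathlike_mono[OF "5.prems"(2), of a] by (simp_all del: One_nat_def)
  then show ?case using inj_pow_leaf unfolding eq by simp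
qed

lemma path_sur_pow:
  assumes "path_sur i n k" "pathlike E a (a + n)"
  shows "sur_pow TYPE('k::field_char_0) E {a..<a + n} i k"
  using assms
proof (induction i n k rule: path_sur.induct)
  case (1 n k)
  show ?case
  proof (cases "k = 0")
    case False
    then show ?thesis using 1 path_ind_unique by (intro sur_pow_deg0) auto
  qed (simp add: sur_pow_0)
next
  case (2 i n)
  show ?case by (rule sur_pow_0) simp
next
  case (3 i k)
  show ?case by (intro sur_pow_empty ind_empty_if) auto
next
  case (4 i k)
  show ?case by (intro sur_pow_empty ind_empty_if) auto
next
  case (5 i n k)
  interpret leaf E "{a..<Suc (Suc (a + n))}" "{a..<a + n}" "{a..<a + n - 1}" "Suc (a + n)" "a + n"
    using 5 by (intro leaf_right) auto
  have eq: "{a..<a + n - 1} = {a..<a + (n - 1)}" by auto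
  have "sur_pow TYPE('k) E {a..<a + n} i (Suc (Suc k))" "sur_pow TYPE('k) E {a..<a + n} (Suc i) k"
    "sur_pow TYPE('k) E {a..<a + (n - 1)} i (Suc k)"
    using 5 pathlike_mono[OF "5.prems"(2), of a] by (simp_all del: One_nat_def)
  then show ?case using sur_pow_leaf unfolding eq by simp
qed

section \<open>Kernel elements of the transpose on paths, read off at the first two vertices\<close>

lemma dn_same_card:
  assumes "finite V" "card S = j" "j > 0 \<or> S = {}"
  shows "dn E V f j S = (if S \<in> ind E V j then f S else 0)"
proof -
  have "R = S" if "R \<in> ind E V j" "S \<subseteq> R" for R
    using card_subset_eq[OF finite_in_ind[OF assms(1) that(1)] that(2)] that assms(2)
    by (simp add: ind_def)
  then have "{R. R \<in> ind E V j \<and> S \<subseteq> R} = (if S \<in> ind E V j then {S} else {})" by auto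
  then show ?thesis by (simp add: dn_def)
qed

lemma ker_dn_pair:
  assumes "ker_dn E {x, y} f 0 1" "x \<noteq> y"
  shows "f {x} + f {y} = 0"
proof -
  have eq: "{R. R \<in> ind E {x, y} 1 \<and> {} \<subseteq> R} = {{x}, {y}}"
    by (auto simp: ind_def indep_def card_1_singleton_iff)
  have "dn E {x, y} f 1 {} = f {x} + f {y}" unfolding dn_def eq using assms(2) by simp
  then show ?thesis using assms(1) by (simp add: ker_dn_def)
qed

text \<open>The case of interest is that of 3q-1 vertices and sets of size q, where the kernel of the dual map
  is spanned by the product of the antisymmetric functionals on the pairs (a, a+1), (a+3, a+4), and
  so on.\<close>

lemma peel_left:
  fixes f :: "nat set \<Rightarrow> 'k::field_char_0"
  assumes p: "pathlike E a b" and ker: "ker_dn E {a..<b} f i (Suc i)"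
    and cs: "i = 0 \<and> b = Suc (Suc a) \<or>
      (\<exists>i'. i = Suc i' \<and> Suc (Suc a) \<le> b \<and> sur_pow TYPE('k) E {Suc (Suc a)..<b} i' 2)"
  shows "\<forall>T\<in>ind E {a..<b} (Suc i). a \<notin> T \<and> Suc a \<notin> T \<longrightarrow> f T = 0" (is ?A)
    and "\<forall>R\<in>ind E {Suc (Suc (Suc a))..<b} i. f (insert (Suc a) R) + f (insert a R) = 0" (is ?B)
    and "\<forall>R\<in>ind E {Suc (Suc a)..<b} i. Suc (Suc a) \<in> R \<longrightarrow> f (insert a R) = 0" (is ?C)
proof -
  have le: "Suc (Suc a) \<le> b" using cs by auto
  interpret leaf E "{a..<b}" "{Suc (Suc a)..<b}" "{Suc (Suc (Suc a))..<b}" a "Suc a"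
    using p le by (rule leaf_left)
  have "?A \<and> ?B \<and> ?C"
  proof (cases i)
    case 0
    then have b: "b = Suc (Suc a)" using cs by auto
    have V: "{a..<b} = {a, Suc a}" using b by auto
    have "f {a} + f {Suc a} = 0" using ker_dn_pair[of E a "Suc a" f] ker 0 V by simp
    moreover have "R = {}" if "R \<in> ind E {Suc (Suc (Suc a))..<b} i" for R
      using that b by (auto simp: ind_def)
    ultimately have ?B by (metis add.commute)
    moreover have ?A
      unfolding V
    proof (intro ballI impI)
      fix T assume "T \<in> ind E {a, Suc a} (Suc i)" "a \<notin> T \<and> Suc a \<notin> T"
      then have "T \<subseteq> {}" "card T = Suc i" by (auto simp: ind_def)
      then show "f T = 0" by simp
    qed
    moreover have ?C using b by (auto simp: ind_def)
    ultimately show ?thesis by blast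
  next
    case (Suc i')
    then have sur: "sur_pow TYPE('k) E {Suc (Suc a)..<b} i' (Suc (Suc 0))"
      using cs by (simp add: numeral_2_eq_2)
    have ker': "ker_dn E {a..<b} f (Suc i') (Suc (Suc (i' + 0)))" using ker Suc by simp
    have ?A
    proof (intro ballI impI)
      fix T assume *: "T \<in> ind E {a..<b} (Suc i)" "a \<notin> T \<and> Suc a \<notin> T"
      then have "T \<in> ind E {Suc (Suc a)..<b} (Suc (Suc (i' + 0)))"
        using V' Suc by (auto simp: ind_def)
      then show "f T = 0" by (rule leaf_avoid[OF ker' sur])
    qed
    \<comment> \<open>With k = 0, the sets S in \<open>leaf_swap\<close> have the size of the sets
      summed over, so each \<open>dn\<close> is a single value of f or zero.\<close>
    moreover note swap = leaf_swap[OF ker' sur, simplified]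
    have ?B
    proof
      fix R assume R: "R \<in> ind E {Suc (Suc (Suc a))..<b} i"
      then have R': "R \<in> ind E {Suc (Suc a)..<b} i" by (rule ind_mono[OF V''])
      have "card R = Suc i'" using R Suc by (simp add: ind_def)
      then show "f (insert (Suc a) R) + f (insert a R) = 0"
        using swap[of R] R R' Suc by (simp add: dn_same_card)
    qed
    moreover have ?C
    proof (intro ballI impI)
      fix Q assume Q: "Q \<in> ind E {Suc (Suc a)..<b} i" "Suc (Suc a) \<in> Q"
      \<comment> \<open>The vertex a + 1 cannot be added to a set containing a + 2, so the term of w
        is absent and the term of a vanishes by itself.\<close>
      then have "Q \<notin> ind E {Suc (Suc (Suc a))..<b} (Suc i')" by (auto simp: ind_def)
      moreover have "card Q = Suc i'" using Q Suc by (simp add: ind_def)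
      ultimately show "f (insert a Q) = 0"
        using swap[of Q] Q Suc by (simp add: dn_same_card)
    qed
    ultimately show ?thesis by blast
  qed
  then show ?A ?B ?C by blast+
qed

section \<open>Tadpoles\<close>

lemma tadpole_edges_iff:
  "{u, v} \<in> tadpole_edges m 3 \<longleftrightarrow>
    (1 \<le> u \<and> v = Suc u \<and> v \<le> m + 3) \<or> (1 \<le> v \<and> u = Suc v \<and> u \<le> m + 3) \<or>
    (u = 1 \<and> v = m) \<or> (u = m \<and> v = 1)" if "m \<ge> 3"
proof
  assume "{u, v} \<in> tadpole_edges m 3"
  then show "(1 \<le> u \<and> v = Suc u \<and> v \<le> m + 3) \<or> (1 \<le> v \<and> u = Suc v \<and> u \<le> m + 3) \<or>
    (u = 1 \<and> v = m) \<or> (u = m \<and> v = 1)"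
    using that unfolding tadpole_edges_def by (auto simp: doubleton_eq_iff)
next
  have E: "{u, Suc u} \<in> tadpole_edges m 3" if u: "1 \<le> u" "Suc u \<le> m + 3" for u
  proof -
    consider "u \<le> m - 1" | "u = m" | "u = m + 1" | "u = m + 2"
      using u by linarith
    then show ?thesis
    proof cases
      case 1
      then have "{u, Suc u} \<in> {{i, i + 1} | i. 1 \<le> i \<and> i \<le> m - 1}" using u by auto
      then show ?thesis unfolding tadpole_edges_def by blast
    next
      case 2
      then show ?thesis unfolding tadpole_edges_def by simp
    next
      case 3
      then have "{u, Suc u} = {m + 1, m + 1 + 1}" by simp
      then have "{u, Suc u} \<in> {{m + j, m + j + 1} | j. 1 \<le> j \<and> j \<le> 3 - 1}"
        by (intro CollectI exI[of _ 1]) auto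
      then show ?thesis unfolding tadpole_edges_def by blast
    next
      case 4
      then have "{u, Suc u} = {m + 2, m + 2 + 1}" by simp
      then have "{u, Suc u} \<in> {{m + j, m + j + 1} | j. 1 \<le> j \<and> j \<le> 3 - 1}"
        by (intro CollectI exI[of _ 2]) auto
      then show ?thesis unfolding tadpole_edges_def by blast
    qed
  qed
  assume "(1 \<le> u \<and> v = Suc u \<and> v \<le> m + 3) \<or> (1 \<le> v \<and> u = Suc v \<and> u \<le> m + 3) \<or>
    (u = 1 \<and> v = m) \<or> (u = m \<and> v = 1)"
  then show "{u, v} \<in> tadpole_edges m 3"
  proof (elim disjE conjE)
    assume "u = 1" "v = m"
    then have "{u, v} = {m, 1}" by auto
    then show ?thesis unfolding tadpole_edges_def by blast
  next
    assume "u = m" "v = 1"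
    then show ?thesis unfolding tadpole_edges_def by blast
  qed (use E[of u] E[of v] in \<open>simp_all add: insert_commute\<close>)
qed

context
  fixes m :: nat
  assumes m: "m \<ge> 3"
begin

text \<open>The condition says that the interval does not contain both ends 1 and m of the
  chord.\<close>

lemma pathlike_tadpole: "1 \<le> a \<Longrightarrow> b \<le> m + 4 \<Longrightarrow> 2 \<le> a \<or> b \<le> m \<Longrightarrow> pathlike (tadpole_edges m 3) a b"
  unfolding pathlike_def using m by (auto simp: tadpole_edges_iff)

text \<open>Removing y_3 and y_2 leaves the cycle with the pendant y_1; removing N[y_2] leaves the
  cycle. In \<open>leaf_bridge\<close>, removing y_1 and x_m leaves a path on m - 1 vertices, and
  removing N[x_m] one on m - 3.\<close>

lemma leaf_end: "leaf (tadpole_edges m 3) {1..m + 3} {1..m + 1} {1..m} (m + 3) (m + 2)"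
  by unfold_locales (use m in \<open>auto simp: link_def tadpole_edges_iff\<close>)

lemma leaf_bridge: "leaf (tadpole_edges m 3) {1..m + 1} {1..<m} {2..<m - 1} (m + 1) m"
  by unfold_locales (use m in \<open>auto simp: link_def tadpole_edges_iff\<close>)

lemma link_cycle: "link (tadpole_edges m 3) {1..m} m = {2..<m - 1}"
  using m by (auto simp: link_def tadpole_edges_iff)

lemma path_inj_tadpole:
  "path_inj j n k \<Longrightarrow> 1 \<le> a \<Longrightarrow> a + n \<le> m + 4 \<Longrightarrow> 2 \<le> a \<or> a + n \<le> m \<Longrightarrow> b = a + n \<Longrightarrow>
    inj_pow TYPE('k::field_char_0) (tadpole_edges m 3) {a..<b} j k"
  using path_inj_pow pathlike_tadpole by blast

lemma path_sur_tadpole: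
  "path_sur j n k \<Longrightarrow> 1 \<le> a \<Longrightarrow> a + n \<le> m + 4 \<Longrightarrow> 2 \<le> a \<or> a + n \<le> m \<Longrightarrow> b = a + n \<Longrightarrow>
    sur_pow TYPE('k::field_char_0) (tadpole_edges m 3) {a..<b} j k"
  using path_sur_pow pathlike_tadpole by blast

lemma cycle_inj:
  assumes "path_inj (Suc j) (m - 1) 1" "path_inj j (m - 3) 1"
  shows "inj_pow TYPE('k::field_char_0) (tadpole_edges m 3) {1..m} (Suc j) 1"
proof (rule inj_pow_vertex[where x = m])
  have "{1..m} - {m} = {1..<m}" using m by auto
  then show "inj_pow TYPE('k) (tadpole_edges m 3) ({1..m} - {m}) (Suc j) 1"
    using path_inj_tadpole[OF assms(1), of 1 m] m by simp
  show "inj_pow TYPE('k) (tadpole_edges m 3) (link (tadpole_edges m 3) {1..m} m) j 1"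
    unfolding link_cycle using m by (intro path_inj_tadpole[OF assms(2)]) auto
qed (use m in auto)

lemma cycle_sur:
  assumes "path_sur (Suc j) (m - 1) 1" "path_sur j (m - 3) 1"
  shows "sur_pow TYPE('k::field_char_0) (tadpole_edges m 3) {1..m} (Suc j) 1"
proof (rule sur_pow_vertex[where x = m])
  have "{1..m} - {m} = {1..<m}" using m by auto
  then show "sur_pow TYPE('k) (tadpole_edges m 3) ({1..m} - {m}) (Suc j) 1"
    using path_sur_tadpole[OF assms(1), of 1 m] m by simp
  show "sur_pow TYPE('k) (tadpole_edges m 3) (link (tadpole_edges m 3) {1..m} m) j 1"
    unfolding link_cycle using m by (intro path_sur_tadpole[OF assms(2)]) auto
qed (use m in auto)

text \<open>The first power in degree j + 1 needs the square in degree j on the cycle with one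
  pendant and the first power in degree j on the cycle. The former splits into the powers 3, 1 and 2
  on paths; the latter adds only the last test, as its other one is already there.\<close>

lemma tadpole_inj:
  assumes "j = 0 \<or> path_inj (j - 1) (m - 1) 3 \<and> path_inj j (m - 1) 1 \<and> path_inj (j - 1) (m - 3) 2
    \<and> path_inj (j - 1) (m - 3) 1"
  shows "inj_pow TYPE('k::field_char_0) (tadpole_edges m 3) {1..m + 3} (Suc j) 1"
proof -
  interpret e: leaf "tadpole_edges m 3" "{1..m + 3}" "{1..m + 1}" "{1..m}" "m + 3" "m + 2" by (rule leaf_end)
  interpret b: leaf "tadpole_edges m 3" "{1..m + 1}" "{1..<m}" "{2..<m - 1}" "m + 1" m by (rule leaf_bridge)
  have "inj_pow TYPE('k) (tadpole_edges m 3) {1..m + 1} j 2 \<and> inj_pow TYPE('k) (tadpole_edges m 3) {1..m} j 1"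
  proof (cases j)
    case 0
    have "{1, m + 1} \<in> ind (tadpole_edges m 3) {1..m + 1} 2" "{1} \<in> ind (tadpole_edges m 3) {1..m} 1"
      using m by (auto simp: ind_def indep_def tadpole_edges_iff)
    then show ?thesis unfolding 0 by (intro conjI inj_pow_deg0) auto
  next
    case (Suc j')
    have "inj_pow TYPE('k) (tadpole_edges m 3) {1..m + 1} (Suc j') (Suc 1)"
    proof (rule b.inj_pow_leaf)
      show "inj_pow TYPE('k) (tadpole_edges m 3) {1..<m} j' (Suc (Suc 1))"
        using assms Suc m by (intro path_inj_tadpole[of _ "m - 1"]) (auto simp: numeral_3_eq_3)
      show "inj_pow TYPE('k) (tadpole_edges m 3) {1..<m} (Suc j') 1"
        using assms Suc m by (intro path_inj_tadpole[of _ "m - 1"]) auto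
      show "inj_pow TYPE('k) (tadpole_edges m 3) {2..<m - 1} j' (Suc 1)"
        using assms Suc m by (intro path_inj_tadpole[of _ "m - 3"]) (auto simp: numeral_2_eq_2)
    qed
    moreover have "inj_pow TYPE('k) (tadpole_edges m 3) {1..m} (Suc j') 1"
      using assms Suc by (intro cycle_inj) auto
    ultimately show ?thesis using Suc by (simp add: numeral_2_eq_2)
  qed
  then show ?thesis
    using e.inj_pow_leaf[of "TYPE('k)" j 0] inj_pow_0[of "{1..m + 1}" "TYPE('k)" "tadpole_edges m 3" "Suc j"]
    by (simp add: numeral_2_eq_2)
qed

text \<open>Same splitting as for injectivity. The cycle remains a hypothesis because for m = 3q+2
  it is not settled by deleting a vertex.\<close>

lemma tadpole_sur:
  assumes "path_sur i (m - 1) 3" "path_sur (Suc i) (m - 1) 1" "path_sur i (m - 3) 2"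
    and C: "sur_pow TYPE('k::field_char_0) (tadpole_edges m 3) {1..m} (Suc i) 1"
  shows "sur_pow TYPE('k) (tadpole_edges m 3) {1..m + 3} (Suc (Suc i)) 1"
proof -
  interpret e: leaf "tadpole_edges m 3" "{1..m + 3}" "{1..m + 1}" "{1..m}" "m + 3" "m + 2" by (rule leaf_end)
  interpret b: leaf "tadpole_edges m 3" "{1..m + 1}" "{1..<m}" "{2..<m - 1}" "m + 1" m by (rule leaf_bridge)
  have "sur_pow TYPE('k) (tadpole_edges m 3) {1..m + 1} (Suc i) (Suc 1)"
  proof (rule b.sur_pow_leaf)
    show "sur_pow TYPE('k) (tadpole_edges m 3) {1..<m} i (Suc (Suc 1))"
      using assms m by (intro path_sur_tadpole[of _ "m - 1"]) (auto simp: numeral_3_eq_3)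
    show "sur_pow TYPE('k) (tadpole_edges m 3) {1..<m} (Suc i) 1"
      using assms m by (intro path_sur_tadpole[of _ "m - 1"]) auto
    show "sur_pow TYPE('k) (tadpole_edges m 3) {2..<m - 1} i (Suc 1)"
      using assms m by (intro path_sur_tadpole[of _ "m - 3"]) (auto simp: numeral_2_eq_2)
  qed
  then show ?thesis
    using e.sur_pow_leaf[of "Suc i" 0] sur_pow_0[of "{1..m + 1}" "TYPE('k)" "tadpole_edges m 3" "Suc (Suc i)"] C
    by (simp add: numeral_2_eq_2)
qed

end

section \<open>The critical degree of surjectivity on cycles\<close>

lemma ind_delete_first: "R \<in> ind E {a..<b} j \<Longrightarrow> a \<notin> R \<Longrightarrow> R \<in> ind E {Suc a..<b} j"
proof -
  assume R: "R \<in> ind E {a..<b} j" "a \<notin> R"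
  have "{a..<b} - {a} = {Suc a..<b}" by auto
  then show ?thesis using ind_delete[OF R] by simp
qed

context
  fixes m :: nat
  assumes m: "m \<ge> 3"
begin

text \<open>The critical case is that of m = 3q+2 and sets of size q+1. Peeling the links of m and 2 gives
  f(m, 2, 5, R) = -f(m, 3, 5, R) = f(m, 3, 6, R) = -f(m, 2, 6, R) = 0.\<close>

lemma cycle_critical:
  assumes q: "m = 3 * q + 2" "q \<ge> 2"
    and s1: "path_sur (q - 2) (m - 5) 2" and s2: "q = 2 \<or> path_sur (q - 3) (m - 8) 2"
    and s3: "path_sur q (m - 1) 1"
  shows "sur_pow TYPE('k::field_char_0) (tadpole_edges m 3) {1..m} q 1"
  unfolding sur_pow_def
proof (intro allI impI ballI)
  let ?E = "tadpole_edges m 3"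
  fix f :: "nat set \<Rightarrow> 'k" and T
  assume "ker_dn ?E {1..m} f q (q + 1)" and T: "T \<in> ind ?E {1..m} (q + 1)"
  obtain p where p: "q = Suc (Suc p)" using q(2) by (metis add_2_eq_Suc le_Suc_ex)
  have m8: "m = 3 * p + 8" using q p by simp
  have ker: "ker_dn ?E {1..m} f (Suc (Suc p)) (Suc (Suc (Suc p)))"
    using \<open>ker_dn ?E {1..m} f q (q + 1)\<close> p by simp
  have linkm: "link ?E {1..m} m = {2..<m - 1}" by (rule link_cycle[OF m])
  have link2: "link ?E {1..m} 2 = {4..<m + 1}" using m8 by (auto simp: link_def tadpole_edges_iff)
  have link3: "link ?E {2..<m - 1} 3 = {5..<m - 1}" using m8 by (auto simp: link_def tadpole_edges_iff)
  define g where "g R = f (insert m R)" for R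
  \<comment> \<open>Three instances of \<open>peel_left\<close>: g on the 3q-1 vertices 2, ..., m-2;
    the contraction by 2 on the 3q-1 vertices 4, ..., m; the contraction of g by 3 on the 3(q-1)-1
    vertices 5, ..., m-2. Their leading pairs are (2, 3), (4, 5) and (5, 6).\<close>
  have kg: "ker_dn ?E {2..<m - 1} g (Suc p) (Suc (Suc p))"
    unfolding g_def linkm[symmetric] by (rule ker_dn_link[OF _ _ ker]) (use m in auto)
  have k2: "ker_dn ?E {4..<m + 1} (\<lambda>R. f (insert 2 R)) (Suc p) (Suc (Suc p))"
    unfolding link2[symmetric] by (rule ker_dn_link[OF _ _ ker]) (use m in auto)
  have k3: "ker_dn ?E {5..<m - 1} (\<lambda>R. g (insert 3 R)) p (Suc p)"
    unfolding link3[symmetric] by (rule ker_dn_link[OF _ _ kg]) (use m8 in auto)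
  have path: "pathlike ?E a b" if "2 \<le> a" "b \<le> m + 4" for a b
    using that by (intro pathlike_tadpole[OF m]) auto
  have sur: "sur_pow TYPE('k) ?E {a..<b} p 2" if "2 \<le> a" "b = a + (m - 5)" "b \<le> m + 4" for a b
    using s1 that p by (intro path_sur_tadpole[OF m, of p "m - 5"]) auto
  have cs: "p = 0 \<and> m - 1 = Suc (Suc 5) \<or>
      (\<exists>i'. p = Suc i' \<and> Suc (Suc 5) \<le> m - 1 \<and> sur_pow TYPE('k) ?E {Suc (Suc 5)..<m - 1} i' 2)"
  proof (cases p)
    case (Suc p')
    have "sur_pow TYPE('k) ?E {7..<m - 1} p' 2"
      using s2 p Suc m8 by (intro path_sur_tadpole[OF m, of p' "m - 8"]) auto
    then show ?thesis using Suc m8 by simp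
  qed (use m8 in simp)
  have eqs: "Suc 2 = 3" "Suc 3 = 4" "Suc 4 = 5" "Suc 5 = 6" "Suc 6 = 7" "Suc 7 = 8" by simp_all
  have csg: "Suc p = 0 \<and> m - 1 = Suc (Suc 2) \<or>
      (\<exists>i'. Suc p = Suc i' \<and> Suc (Suc 2) \<le> m - 1 \<and> sur_pow TYPE('k) ?E {Suc (Suc 2)..<m - 1} i' 2)"
    unfolding eqs using sur[of 4 "m - 1"] m8 by auto
  have cs2: "Suc p = 0 \<and> m + 1 = Suc (Suc 4) \<or>
      (\<exists>i'. Suc p = Suc i' \<and> Suc (Suc 4) \<le> m + 1 \<and> sur_pow TYPE('k) ?E {Suc (Suc 4)..<m + 1} i' 2)"
    unfolding eqs using sur[of 6 "m + 1"] m8 by auto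
  have p2: "pathlike ?E 2 (m - 1)" and p4: "pathlike ?E 4 (m + 1)" and p5: "pathlike ?E 5 (m - 1)"
    by (intro path; simp)+
  note pg = peel_left[OF p2 kg csg, unfolded eqs]
  note pk2 = peel_left[OF p4 k2 cs2, unfolded eqs]
  note pk3 = peel_left[OF p5 k3 cs, unfolded eqs]
  \<comment> \<open>Seen from the link of 2, the set R together with m avoids the leading pair (4,
    5), so the value is zero.\<close>
  have view2: "g (insert 2 R) = 0" if R: "R \<in> ind ?E {5..<m - 1} (Suc p)" "5 \<notin> R" for R
  proof -
    have R6: "R \<in> ind ?E {6..<m - 1} (Suc p)"
      using ind_delete_first[OF R] by (simp only: eqs)
    have "{6..<m - 1} \<subseteq> link ?E {4..<m + 1} m"
      using m8 by (auto simp: link_def tadpole_edges_iff)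
    then have "insert m R \<in> ind ?E {4..<m + 1} (Suc (Suc p))"
      using m8 ind_mono[OF _ R6] by (intro insert_in_ind) auto
    moreover have "4 \<notin> insert m R \<and> 5 \<notin> insert m R"
      using R6 m8 by (auto simp: ind_def subset_iff)
    ultimately have "f (insert 2 (insert m R)) = 0" by (rule pk2(1)[rule_format])
    then show ?thesis by (simp add: g_def insert_commute)
  qed
  have claim: "g (insert 2 R) = 0" if R: "R \<in> ind ?E {5..<m - 1} (Suc p)" for R
  proof (cases "5 \<in> R")
    case True
    define Q where "Q = R - {5}"
    have RQ: "R = insert 5 Q" using True by (auto simp: Q_def)
    have link5: "link ?E {5..<m - 1} 5 = {7..<m - 1}"
      using m8 by (auto simp: link_def tadpole_edges_iff)
    have Q: "Q \<in> ind ?E {7..<m - 1} p"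
      using ind_link[OF _ R True] unfolding link5 Q_def by simp
    have swap: "g (insert 3 S) + g (insert 2 S) = 0" if "S \<in> ind ?E {5..<m - 1} (Suc p)" for S
      by (rule pg(2)[rule_format, OF that])
    have "g (insert 3 (insert 5 Q)) = 0"
    \<comment> \<open>If 7 is present, 5 cannot be exchanged for 6, but then the third part of
      \<open>peel_left\<close> gives zero at once.\<close>
    proof (cases "7 \<in> Q")
      case True
      then show ?thesis by (rule pk3(3)[rule_format, OF Q])
    next
      case False
      have Q8: "Q \<in> ind ?E {8..<m - 1} p"
        using ind_delete_first[OF Q False] by (simp only: eqs)
      have link6: "link ?E {5..<m - 1} 6 = {8..<m - 1}"
        using m8 Q8 by (auto simp: link_def tadpole_edges_iff)
      have "6 \<in> {5..<m - 1}" using m8 by simp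
      then have Q6: "insert 6 Q \<in> ind ?E {5..<m - 1} (Suc p)"
        using Q8 by (intro insert_in_ind) (simp_all add: link6 del: One_nat_def)
      have "5 \<notin> insert 6 Q" using Q by (auto simp: ind_def)
      then have "g (insert 3 (insert 6 Q)) = 0"
        using view2[OF Q6] swap[OF Q6] by simp
      moreover have "g (insert 3 (insert 6 Q)) + g (insert 3 (insert 5 Q)) = 0"
        by (rule pk3(2)[rule_format, OF Q8])
      ultimately show ?thesis by simp
    qed
    then show ?thesis using swap[OF R] by (simp add: RQ)
  qed (rule view2[OF R])
  have g0: "g S = 0" if S: "S \<in> ind ?E {2..<m - 1} (Suc (Suc p))" for S
  proof -
    have l2: "link ?E {2..<m - 1} 2 = {4..<m - 1}" using m8 by (auto simp: link_def tadpole_edges_iff)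
    consider "2 \<in> S" | "2 \<notin> S" "3 \<in> S" | "2 \<notin> S" "3 \<notin> S" by blast
    then show ?thesis
    proof cases
      case 1
      then have R: "S - {2} \<in> ind ?E {4..<m - 1} (Suc p)" and S2: "insert 2 (S - {2}) = S"
        using ind_link[OF _ S, of 2] unfolding l2 by auto
      have "g (insert 2 (S - {2})) = 0"
      proof (cases "4 \<in> S - {2}")
        case True
        then show ?thesis by (intro pg(3)[rule_format, OF R])
      next
        case False
        then have "S - {2} \<in> ind ?E {5..<m - 1} (Suc p)"
          using ind_delete_first[OF R False] by (simp only: eqs)
        then show ?thesis by (rule claim)
      qed
      then show ?thesis by (simp only: S2)
    next
      case 2
      then have R: "S - {3} \<in> ind ?E {5..<m - 1} (Suc p)" and S2: "insert 3 (S - {3}) = S"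
        using ind_link[OF _ S, of 3] unfolding link3 by auto
      have "g (insert 3 (S - {3})) + g (insert 2 (S - {3})) = 0" by (rule pg(2)[rule_format, OF R])
      then have "g (insert 3 (S - {3})) = 0" using claim[OF R] by simp
      then show ?thesis by (simp only: S2)
    next
      case 3
      then show ?thesis by (intro pg(1)[rule_format, OF S] conjI)
    qed
  qed
  show "f T = 0"
  proof (cases "m \<in> T")
    case True
    then have "g (T - {m}) = 0"
      using ind_link[of "{1..m}" T ?E "Suc (Suc p)" m] T p linkm by (intro g0) simp
    then show ?thesis using True by (simp add: g_def insert_absorb)
  next
    case False
    have "{1..m} - {m} = {1..<m}" using m by auto
    moreover have "ker_dn ?E ({1..m} - {m}) f (Suc (Suc p)) (Suc (Suc (Suc p)))"
      using g0 m linkm by (intro ker_dn_delete[OF _ _ ker]) (auto simp: g_def)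
    ultimately have k: "ker_dn ?E {1..<m} f (Suc (Suc p)) (Suc (Suc (Suc p)))" by simp
    have s: "sur_pow TYPE('k) ?E {1..<m} (Suc (Suc p)) 1"
      using s3 p m by (intro path_sur_tadpole[OF m, of _ "m - 1"]) auto
    show ?thesis
      by (rule sur_powD[OF s k]) (use T p False \<open>{1..m} - {m} = {1..<m}\<close> ind_delete[OF T False] in simp_all)
  qed
qed

end

text \<open>The case q = 1. The non-edges of the pentagon again form a 5-cycle, and the kernel
  condition at each vertex makes the values change sign along it. As 5 is odd, twice each value is
  zero.\<close>

lemma cycle_critical_5: "sur_pow TYPE('k::field_char_0) (tadpole_edges 5 3) {1..5} 1 1"
  unfolding sur_pow_def
proof (intro allI impI ballI)
  let ?E = "tadpole_edges 5 3"
  fix f :: "nat set \<Rightarrow> 'k" and T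
  assume "ker_dn ?E {1..5} f 1 (1 + 1)" and T: "T \<in> ind ?E {1..5} (1 + 1)"
  then have ker: "ker_dn ?E {1..5} f (Suc 0) (Suc (Suc 0))" by simp
  have pair: "f {x, y} + f {x, z} = 0"
    if "x \<in> {1..5}" "link ?E {1..5} x = {y, z}" "y \<noteq> z" for x y z
    using ker_dn_pair[of ?E y z "\<lambda>R. f (insert x R)"] ker_dn_link[OF _ that(1) ker] that(2,3) by simp
  have l1: "link ?E {1..5} 1 = {3, 4}" and l2: "link ?E {1..5} 2 = {4, 5}"
    and l3: "link ?E {1..5} 3 = {1, 5}" and l4: "link ?E {1..5} 4 = {1, 2}"
    and l5: "link ?E {1..5} 5 = {2, 3}"
    by (auto simp: link_def tadpole_edges_iff)
  have eqs: "f {1, 3} + f {1, 4} = 0" "f {2, 4} + f {2, 5} = 0" "f {1, 3} + f {3, 5} = 0"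
    "f {1, 4} + f {2, 4} = 0" "f {2, 5} + f {3, 5} = 0"
    using pair[OF _ l1] pair[OF _ l2] pair[OF _ l3] pair[OF _ l4] pair[OF _ l5]
    by (simp_all add: insert_commute)
  have "2 * f {1, 3} = 0"
    using eqs by algebra
  then have f13: "f {1, 3} = 0" by simp
  then have z: "f {1, 3} = 0" "f {1, 4} = 0" "f {2, 4} = 0" "f {2, 5} = 0" "f {3, 5} = 0"
    using eqs by auto
  from T have "card T = 2" by (simp add: ind_def)
  then obtain x y where xy: "T = {x, y}" "x \<noteq> y" by (auto simp: card_2_iff)
  then have "x \<in> {1, 2, 3, 4, 5}" "y \<in> {1, 2, 3, 4, 5}" "{x, y} \<notin> ?E"
    using T by (auto simp: ind_def indep_def)
  moreover have "f {3, 1} = 0" "f {4, 1} = 0" "f {4, 2} = 0" "f {5, 2} = 0" "f {5, 3} = 0"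
    using z by (simp_all add: insert_commute)
  ultimately show "f T = 0"
    using z xy by (elim insertE emptyE) (simp_all add: tadpole_edges_iff)
qed

text \<open>For the listed m this equals (m + 6) div 4, where \<open>not_lin_inj_tadpole\<close>
  excludes injectivity, and also 1 + m div 3, the first degree in which
  \<open>not_lin_sur_tadpole\<close> does not exclude surjectivity.\<close>

definition first_sur :: "nat \<Rightarrow> nat" where
  "first_sur m = (if m < 6 then 2 else if m < 9 then 3 else if m < 12 then 4 else 5)"

lemma tadpole_inj_list:
  assumes "m \<in> {3, 4, 5, 6, 7, 8, 10, 11, 14}" "j < first_sur m"
  shows "inj_pow TYPE('k::field_char_0) (tadpole_edges m 3) {1..m + 3} j 1"
proof (cases j)
  case 0
  have "{1} \<in> ind (tadpole_edges m 3) {1..m + 3} 1" by (auto simp: ind_def indep_def)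
  then show ?thesis unfolding 0 by (intro inj_pow_deg0) auto
next
  case (Suc i)
  have "i < 4" using assms(2) Suc by (auto simp: first_sur_def split: if_splits)
  then have "i \<in> {0, 1, 2, 3}" by auto
  then have "i = 0 \<or> path_inj (i - 1) (m - 1) 3 \<and> path_inj i (m - 1) 1
    \<and> path_inj (i - 1) (m - 3) 2 \<and> path_inj (i - 1) (m - 3) 1"
    using assms Suc by (auto simp: first_sur_def eval_nat_numeral)
  then show ?thesis unfolding Suc using assms(1) by (intro tadpole_inj) auto
qed

lemma tadpole_sur_list:
  assumes "m \<in> {3, 4, 5, 6, 7, 8, 10, 11, 14}" "j \<ge> first_sur m"
  shows "sur_pow TYPE('k::field_char_0) (tadpole_edges m 3) {1..m + 3} j 1"
proof -
  define i where "i = first_sur m - 2"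
  have i: "first_sur m = Suc (Suc i)" by (simp add: i_def first_sur_def)
  have C: "sur_pow TYPE('k) (tadpole_edges m 3) {1..m} (Suc i) 1"
  proof -
    \<comment> \<open>The values 5, 8, 11, 14 are those congruent to 2 modulo 3, with q = 1, 2, 3,
      4.\<close>
    consider "m \<in> {3, 4, 6, 7, 10}" | "m = 5" | "m \<in> {8, 11, 14}" using assms(1) by auto
    then show ?thesis
    proof cases
      case 1
      then show ?thesis by (intro cycle_sur) (auto simp: i_def first_sur_def eval_nat_numeral)
    next
      case 2
      then show ?thesis using cycle_critical_5 by (simp add: i_def first_sur_def)
    next
      case 3
      then show ?thesis by (intro cycle_critical) (auto simp: i_def first_sur_def eval_nat_numeral)
    qed
  qed
  have "sur_pow TYPE('k) (tadpole_edges m 3) {1..m + 3} (Suc (Suc i)) 1"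
  proof (rule tadpole_sur[OF _ _ _ _ C])
    show "path_sur i (m - 1) 3" "path_sur (Suc i) (m - 1) 1" "path_sur i (m - 3) 2"
      using assms(1) by (auto simp: i_def first_sur_def eval_nat_numeral)
  qed (use assms(1) in auto)
  then show ?thesis by (rule sur_pow_mono[rotated]) (use assms(2) i in auto)
qed

section \<open>Duality\<close>

text \<open>Induction on the rows: a solution for the earlier rows is corrected along a vector that
  they annihilate and the new row does not. Without such a vector the new row would be a combination
  of the earlier ones.\<close>

lemma solvable_if_rows_independent:
  fixes M :: "'a \<Rightarrow> 'b \<Rightarrow> 'k::field"
  assumes "finite X" "finite Y"
    and "\<And>\<phi>. (\<forall>y\<in>Y. (\<Sum>x\<in>X. \<phi> x * M x y) = 0) \<Longrightarrow> (\<forall>x\<in>X. \<phi> x = 0)"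
  shows "\<exists>f. \<forall>x\<in>X. (\<Sum>y\<in>Y. M x y * f y) = g x"
  using assms
proof (induction X arbitrary: g rule: finite_induct)
  case (insert x0 X)
  have indX: "\<forall>x\<in>X. \<phi> x = 0" if z: "\<forall>y\<in>Y. (\<Sum>x\<in>X. \<phi> x * M x y) = 0" for \<phi>
  proof -
    have "(\<Sum>x\<in>insert x0 X. (if x = x0 then 0 else \<phi> x) * M x y) = (\<Sum>x\<in>X. \<phi> x * M x y)" for y
      using insert.hyps by (auto intro!: sum.cong)
    then have 0: "\<forall>x\<in>insert x0 X. (if x = x0 then 0 else \<phi> x) = 0"
      using z by (intro insert.prems(2)) auto
    show ?thesis
    proof
      fix x assume "x \<in> X"
      then have "x \<noteq> x0" using insert.hyps by blast
      then show "\<phi> x = 0" using bspec[OF 0, of x] \<open>x \<in> X\<close> by simp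
    qed
  qed
  have IH: "\<exists>f. \<forall>x\<in>X. (\<Sum>y\<in>Y. M x y * f y) = h x" for h
    by (rule insert.IH[OF insert.prems(1)]) (rule indX)
  have "\<forall>z. \<exists>f. \<forall>x\<in>X. (\<Sum>y\<in>Y. M x y * f y) = (if x = z then 1 else 0)"
    by (intro allI IH)
  from choice[OF this] obtain e where e:
    "\<And>z x. x \<in> X \<Longrightarrow> (\<Sum>y\<in>Y. M x y * e z y) = (if x = z then 1 else 0)"
    by blast
  \<comment> \<open>\<open>e\<close> is a dual basis for the rows in X, and \<open>c y\<close> is
    the unit vector at y projected to their common kernel.\<close>
  define c where "c y y' = (if y' = y then 1 else 0) - (\<Sum>x\<in>X. M x y * e x y')" for y y'
  have Mc: "(\<Sum>y'\<in>Y. M x' y' * c y y') = M x' y - (\<Sum>x\<in>X. M x y * (\<Sum>y'\<in>Y. M x' y' * e x y'))"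
    if "y \<in> Y" for x' y
  proof -
    have "(\<Sum>y'\<in>Y. M x' y' * c y y')
        = (\<Sum>y'\<in>Y. M x' y' * (if y' = y then 1 else 0)) - (\<Sum>y'\<in>Y. \<Sum>x\<in>X. M x y * (M x' y' * e x y'))"
      unfolding c_def by (simp add: right_diff_distrib sum_subtractf sum_distrib_left mult.left_commute)
    also have "(\<Sum>y'\<in>Y. \<Sum>x\<in>X. M x y * (M x' y' * e x y')) = (\<Sum>x\<in>X. M x y * (\<Sum>y'\<in>Y. M x' y' * e x y'))"
      by (subst sum.swap) (simp add: sum_distrib_left)
    finally show ?thesis using that \<open>finite Y\<close> by (simp add: sum.delta' if_distrib[of "\<lambda>t. _ * t"] cong: if_cong)
  qed
  have kerX: "(\<Sum>y'\<in>Y. M x' y' * c y y') = 0" if "y \<in> Y" "x' \<in> X" for x' y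
    using that insert.hyps(1) by (simp add: Mc e sum.delta' if_distrib[of "\<lambda>t. _ * t"] cong: if_cong)
  have "\<exists>y\<in>Y. (\<Sum>y'\<in>Y. M x0 y' * c y y') \<noteq> 0"
  proof (rule ccontr)
    assume "\<not> ?thesis"
    then have z: "M x0 y - (\<Sum>x\<in>X. M x y * (\<Sum>y'\<in>Y. M x0 y' * e x y')) = 0" if "y \<in> Y" for y
      using that Mc by metis
    \<comment> \<open>The row x0 would be the combination of the rows x in X with coefficients its
      values on \<open>e x\<close>.\<close>
    define \<phi> where "\<phi> x = (if x = x0 then 1 else - (\<Sum>y'\<in>Y. M x0 y' * e x y'))" for x
    have "(\<Sum>x\<in>insert x0 X. \<phi> x * M x y) = 0" if "y \<in> Y" for y
    proof -
      have "(\<Sum>x\<in>X. \<phi> x * M x y) = - (\<Sum>x\<in>X. M x y * (\<Sum>y'\<in>Y. M x0 y' * e x y'))"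
        unfolding sum_negf[symmetric] using insert.hyps by (intro sum.cong) (auto simp: \<phi>_def)
      then show ?thesis using insert.hyps z[OF that] by (simp add: \<phi>_def)
    qed
    then have "\<phi> x0 = 0" using insert.prems(2)[of \<phi>] by blast
    then show False by (simp add: \<phi>_def)
  qed
  then obtain y0 where y0: "y0 \<in> Y" "(\<Sum>y'\<in>Y. M x0 y' * c y0 y') \<noteq> 0" by blast
  obtain f where f: "\<And>x. x \<in> X \<Longrightarrow> (\<Sum>y\<in>Y. M x y * f y) = g x" using IH by blast
  define t where "t = (g x0 - (\<Sum>y\<in>Y. M x0 y * f y)) / (\<Sum>y'\<in>Y. M x0 y' * c y0 y')"
  have split: "(\<Sum>y\<in>Y. M x y * (f y + t * c y0 y)) = (\<Sum>y\<in>Y. M x y * f y) + t * (\<Sum>y\<in>Y. M x y * c y0 y)" for x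
    by (simp add: distrib_left sum.distrib sum_distrib_left mult.left_commute)
  show ?case
  proof (intro exI[of _ "\<lambda>y. f y + t * c y0 y"] ballI)
    fix x assume "x \<in> insert x0 X"
    then show "(\<Sum>y\<in>Y. M x y * (f y + t * c y0 y)) = g x"
      unfolding split using f kerX[OF y0(1)] y0(2) by (auto simp: t_def)
  qed
qed simp

text \<open>Coefficients a are arbitrary, since a failure of the WLP must be shown for every linear
  form. Functions live on all sets, but only their values at independent sets enter.\<close>

definition lin_inj :: "nat set set \<Rightarrow> nat \<Rightarrow> (nat \<Rightarrow> 'k::comm_ring_1) \<Rightarrow> nat \<Rightarrow> bool" where
  "lin_inj E N a j \<longleftrightarrow> (\<forall>f. (\<forall>T\<in>ind E {1..N} (Suc j). (\<Sum>v\<in>T. a v * f (T - {v})) = 0) \<longrightarrow>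
     (\<forall>S\<in>ind E {1..N} j. f S = 0))"

definition lin_sur :: "nat set set \<Rightarrow> nat \<Rightarrow> (nat \<Rightarrow> 'k::comm_ring_1) \<Rightarrow> nat \<Rightarrow> bool" where
  "lin_sur E N a j \<longleftrightarrow> (\<forall>g. \<exists>f. \<forall>T\<in>ind E {1..N} (Suc j). g T = (\<Sum>v\<in>T. a v * f (T - {v})))"

lemma up_codim1:
  assumes "finite T" "card T = Suc j"
  shows "up f j T = (\<Sum>v\<in>T. f (T - {v}))"
proof -
  have "{R. R \<subseteq> T \<and> card R = j} = (\<lambda>v. T - {v}) ` T"
  proof (intro equalityI subsetI)
    fix R assume R: "R \<in> {R. R \<subseteq> T \<and> card R = j}"
    then have "finite R" using assms(1) finite_subset by blast
    then have "card (T - R) = 1" using assms R by (simp add: card_Diff_subset)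
    then obtain v where "T - R = {v}" by (auto simp: card_1_singleton_iff)
    then have "v \<in> T" "R = T - {v}" using R by auto
    then show "R \<in> (\<lambda>v. T - {v}) ` T" by blast
  qed (use assms in auto)
  moreover have "inj_on (\<lambda>v. T - {v}) T" by (intro inj_onI) blast
  ultimately show ?thesis by (simp add: up_def sum.reindex)
qed

lemma lin_inj_if_inj_pow:
  assumes "inj_pow TYPE('k::comm_ring_1) E {1..N} j 1"
  shows "lin_inj E N (\<lambda>_. 1 :: 'k) j"
  unfolding lin_inj_def
proof (intro allI impI)
  fix f :: "nat set \<Rightarrow> 'k"
  assume *: "\<forall>T\<in>ind E {1..N} (Suc j). (\<Sum>v\<in>T. 1 * f (T - {v})) = 0"
  have "up f j T = 0" if "T \<in> ind E {1..N} (j + 1)" for T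
  proof -
    have "finite T" "card T = Suc j" using that finite_in_ind by (auto simp: ind_def)
    then show ?thesis using * that by (simp add: up_codim1)
  qed
  then show "\<forall>S\<in>ind E {1..N} j. f S = 0" using assms unfolding inj_pow_def by blast
qed

lemma lin_sur_if_sur_pow:
  assumes "sur_pow TYPE('k::field) E {1..N} j 1"
  shows "lin_sur E N (\<lambda>_. 1 :: 'k) j"
  unfolding lin_sur_def
proof
  fix g :: "nat set \<Rightarrow> 'k"
  let ?X = "ind E {1..N} (Suc j)" and ?Y = "ind E {1..N} j"
  have fin: "finite ?X" "finite ?Y" by (simp_all add: finite_ind)
  have "\<exists>f. \<forall>T\<in>?X. (\<Sum>S\<in>?Y. (if S \<subseteq> T then 1 else 0) * f S) = g T"
  proof (rule solvable_if_rows_independent[OF fin])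
    fix \<phi> :: "nat set \<Rightarrow> 'k"
    assume z: "\<forall>S\<in>?Y. (\<Sum>T\<in>?X. \<phi> T * (if S \<subseteq> T then 1 else 0)) = 0"
    have eq: "dn E {1..N} \<phi> (Suc j) S = (\<Sum>T\<in>?X. \<phi> T * (if S \<subseteq> T then 1 else 0))" for S
      unfolding dn_def using fin by (intro sum.mono_neutral_cong_left) auto
    have "dn E {1..N} \<phi> (Suc j) S = 0" if "card S = j" for S
    proof (cases "S \<in> ?Y")
      case False
      then have "{T. T \<in> ?X \<and> S \<subseteq> T} = {}" using that ind_subset by blast
      then show ?thesis unfolding dn_def by (simp only: sum.empty)
    qed (use eq z in simp)
    then have "ker_dn E {1..N} \<phi> j (j + 1)" by (simp add: ker_dn_def)
    then show "\<forall>T\<in>?X. \<phi> T = 0" using assms unfolding sur_pow_def by simp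
  qed
  then obtain f where f: "\<And>T. T \<in> ?X \<Longrightarrow> (\<Sum>S\<in>?Y. (if S \<subseteq> T then 1 else 0) * f S) = g T" by blast
  have "g T = (\<Sum>v\<in>T. 1 * f (T - {v}))" if T: "T \<in> ?X" for T
  proof -
    have "finite T" "card T = Suc j" using T finite_in_ind by (auto simp: ind_def)
    then have "(\<Sum>v\<in>T. f (T - {v})) = up f j T" by (simp add: up_codim1)
    also have "\<dots> = (\<Sum>S\<in>?Y. (if S \<subseteq> T then 1 else 0) * f S)"
      unfolding up_def using fin T ind_subset[OF T]
      by (intro sum.mono_neutral_cong_left) (auto simp: ind_def)
    finally show ?thesis using f[OF T] by simp
  qed
  then show "\<exists>f. \<forall>T\<in>?X. g T = (\<Sum>v\<in>T. 1 * f (T - {v}))" by blast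
qed

section \<open>The algebra in terms of independent sets\<close>

definition expo :: "nat set \<Rightarrow> (nat \<Rightarrow>\<^sub>0 nat)" where
  "expo S = (\<Sum>i\<in>S. Poly_Mapping.single i 1)"

lemma lookup_expo: "finite S \<Longrightarrow> Poly_Mapping.lookup (expo S) i = (if i \<in> S then 1 else 0)"
  by (simp add: expo_def lookup_sum lookup_single when_def)

lemma keys_expo: "finite S \<Longrightarrow> Poly_Mapping.keys (expo S) = S"
  by (auto simp: in_keys_iff lookup_expo split: if_splits)

lemma expo_remove: "finite S \<Longrightarrow> v \<in> S \<Longrightarrow> expo S = Poly_Mapping.single v 1 + expo (S - {v})"
  unfolding expo_def by (rule sum.remove)

lemma mdeg_expo: "finite S \<Longrightarrow> mdeg (expo S) = card S"
  by (simp add: mdeg_def keys_expo lookup_expo)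

lemma expo_eqI:
  assumes "\<And>i. Poly_Mapping.lookup \<alpha> i \<le> 1"
  shows "\<alpha> = expo (Poly_Mapping.keys \<alpha>)"
proof (rule poly_mapping_eqI)
  fix i
  show "Poly_Mapping.lookup \<alpha> i = Poly_Mapping.lookup (expo (Poly_Mapping.keys \<alpha>)) i"
    using assms[of i] by (auto simp: lookup_expo in_keys_iff)
qed

lemma lookup_single_mult_add:
  fixes p :: "'k::comm_ring_1 mpoly"
  shows "Poly_Mapping.lookup (Poly_Mapping.single \<beta> c * p) (\<beta> + \<delta>) = c * Poly_Mapping.lookup p \<delta>"
  by (simp add: lookup_mult lookup_single when_mult)

lemma lookup_single_mult_not:
  fixes p :: "'k::comm_ring_1 mpoly"
  assumes "\<And>\<delta>. \<gamma> \<noteq> \<beta> + \<delta>"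
  shows "Poly_Mapping.lookup (Poly_Mapping.single \<beta> c * p) \<gamma> = 0"
  using assms by (simp add: lookup_mult lookup_single when_mult)

lemma mpoly_sum_single:
  fixes p :: "'k::comm_ring_1 mpoly"
  assumes "finite A" "Poly_Mapping.keys p \<subseteq> A"
  shows "p = (\<Sum>\<alpha>\<in>A. Poly_Mapping.single \<alpha> (Poly_Mapping.lookup p \<alpha>))"
proof (rule poly_mapping_eqI)
  fix \<gamma>
  show "Poly_Mapping.lookup p \<gamma>
      = Poly_Mapping.lookup (\<Sum>\<alpha>\<in>A. Poly_Mapping.single \<alpha> (Poly_Mapping.lookup p \<alpha>)) \<gamma>"
    using assms by (auto simp: lookup_sum lookup_single when_def in_keys_iff)
qed

lemma Var_square: "Var i ^ 2 = (Poly_Mapping.single (Poly_Mapping.single i 2) 1 :: 'k::comm_ring_1 mpoly)"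
  by (simp add: Var_def power2_eq_square mult_single numeral_2_eq_2 flip: single_add)

lemma Var_mult:
  "Var i * Var j = (Poly_Mapping.single (Poly_Mapping.single i 1 + Poly_Mapping.single j 1) 1 :: 'k::comm_ring_1 mpoly)"
  by (simp add: Var_def mult_single)

text \<open>Each multiple of a generator involves only monomials divisible by a square or by an
  edge, and \<open>expo S\<close> is divisible by neither.\<close>

lemma lookup_artin_ideal:
  fixes p :: "'k::comm_ring_1 mpoly"
  assumes "p \<in> artin_ideal K N E" "finite S" "indep E S"
  shows "Poly_Mapping.lookup p (expo S) = 0"
  using assms(1) unfolding artin_ideal_def
proof (induction rule: ideal_gen.induct)
  case (gen g r)
  have "\<exists>\<beta>. g = Poly_Mapping.single \<beta> 1 \<and> (\<forall>\<delta>. expo S \<noteq> \<beta> + \<delta>)"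
    using gen.hyps(1)
  proof
    assume "g \<in> {Var i ^ 2 | i. i \<in> {1..N}}"
    then obtain i where "g = Var i ^ 2" by blast
    moreover have "expo S \<noteq> Poly_Mapping.single i 2 + \<delta>" for \<delta>
    proof
      assume "expo S = Poly_Mapping.single i 2 + \<delta>"
      then have "Poly_Mapping.lookup (expo S) i = 2 + Poly_Mapping.lookup \<delta> i"
        by (simp add: lookup_add)
      then show False using assms(2) by (simp add: lookup_expo split: if_splits)
    qed
    ultimately show ?thesis by (auto simp: Var_square)
  next
    assume "g \<in> {Var i * Var j | i j. {i, j} \<in> E}"
    then obtain i j where ij: "g = Var i * Var j" "{i, j} \<in> E" by blast
    moreover have "expo S \<noteq> Poly_Mapping.single i 1 + Poly_Mapping.single j 1 + \<delta>" for \<delta>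
    proof
      assume eq: "expo S = Poly_Mapping.single i 1 + Poly_Mapping.single j 1 + \<delta>"
      have "Poly_Mapping.lookup (expo S) i \<ge> 1" "Poly_Mapping.lookup (expo S) j \<ge> 1"
        "i = j \<Longrightarrow> Poly_Mapping.lookup (expo S) i \<ge> 2"
        by (simp_all add: eq lookup_add lookup_single)
      then have "i \<in> S \<and> j \<in> S \<and> i \<noteq> j" using assms(2) by (auto simp: lookup_expo split: if_splits)
      then show False using assms(3) ij(2) unfolding indep_def by blast
    qed
    ultimately show ?thesis by (auto simp: Var_mult)
  qed
  then show ?case using lookup_single_mult_not by (metis mult.commute)
qed (simp_all add: lookup_add)

lemma artin_ideal_sum:
  "(\<And>x. x \<in> A \<Longrightarrow> h x \<in> artin_ideal K N E) \<Longrightarrow> (\<Sum>x\<in>A. h x) \<in> artin_ideal K N E"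
  unfolding artin_ideal_def
  by (induction A rule: infinite_finite_induct) (auto intro: ideal_gen.zero ideal_gen.add)

lemma single_in_polyring:
  "Poly_Mapping.keys \<alpha> \<subseteq> {1..N} \<Longrightarrow> Poly_Mapping.single \<alpha> c \<in> polyring N"
  by (auto simp: polyring_def split: if_splits)

text \<open>Every other monomial lies in the ideal: an exponent of at least 2 gives a square, and a
  squarefree monomial with dependent support contains an edge.\<close>

lemma artin_idealI:
  fixes p :: "'k::comm_ring_1 mpoly"
  assumes p: "p \<in> polyring N"
    and z: "\<And>S. S \<subseteq> {1..N} \<Longrightarrow> indep E S \<Longrightarrow> Poly_Mapping.lookup p (expo S) = 0"
  shows "p \<in> artin_ideal K N E"
proof -
  have "Poly_Mapping.single \<alpha> (Poly_Mapping.lookup p \<alpha>) \<in> artin_ideal K N E"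
    if \<alpha>: "\<alpha> \<in> Poly_Mapping.keys p" for \<alpha>
  proof -
    let ?c = "Poly_Mapping.lookup p \<alpha>"
    have sub: "Poly_Mapping.keys \<alpha> \<subseteq> {1..N}" using p \<alpha> by (auto simp: polyring_def)
    have mem: "Poly_Mapping.single \<alpha> ?c \<in> artin_ideal K N E"
      if g: "(Poly_Mapping.single \<beta> 1 :: 'k mpoly) \<in> {Var i ^ 2 | i. i \<in> {1..N}} \<union> {Var i * Var j | i j. {i, j} \<in> E}"
        and \<delta>: "\<alpha> = \<delta> + \<beta>" for \<beta> \<delta>
    proof -
      have "Poly_Mapping.keys \<delta> \<subseteq> Poly_Mapping.keys \<alpha>"
        unfolding \<delta> by (auto simp: in_keys_iff lookup_add)
      then have "Poly_Mapping.single \<delta> ?c \<in> polyring N"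
        using sub by (intro single_in_polyring) auto
      then have "Poly_Mapping.single \<delta> ?c * Poly_Mapping.single \<beta> 1 \<in> artin_ideal K N E"
        unfolding artin_ideal_def using g by (intro ideal_gen.gen)
      then show ?thesis by (simp add: mult_single \<delta>)
    qed
    show ?thesis
    proof (cases "\<exists>i. Poly_Mapping.lookup \<alpha> i \<ge> 2")
      case True
      then obtain i where i: "Poly_Mapping.lookup \<alpha> i \<ge> 2" by blast
      then have "i \<in> Poly_Mapping.keys \<alpha>" by (simp add: in_keys_iff)
      then have "i \<in> {1..N}" using sub by blast
      moreover have "\<alpha> = (\<alpha> - Poly_Mapping.single i 2) + Poly_Mapping.single i 2"
        using i by (intro poly_mapping_eqI) (auto simp: lookup_add lookup_minus lookup_single when_def)
      ultimately show ?thesis by (intro mem) (auto simp flip: Var_square)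
    next
      case False
      then have \<alpha>e: "\<alpha> = expo (Poly_Mapping.keys \<alpha>)"
        by (intro expo_eqI) (metis Suc_1 not_less_eq_eq)
      then have "\<not> indep E (Poly_Mapping.keys \<alpha>)"
        using z[OF sub] \<alpha> by (metis in_keys_iff)
      then obtain u v where uv: "u \<in> Poly_Mapping.keys \<alpha>" "v \<in> Poly_Mapping.keys \<alpha>" "u \<noteq> v" "{u, v} \<in> E"
        unfolding indep_def by blast
      let ?S = "Poly_Mapping.keys \<alpha>"
      have "expo ?S = Poly_Mapping.single u 1 + expo (?S - {u})"
        using uv by (intro expo_remove) auto
      also have "expo (?S - {u}) = Poly_Mapping.single v 1 + expo (?S - {u} - {v})"
        using uv by (intro expo_remove) auto
      finally have "\<alpha> = Poly_Mapping.single u 1 + (Poly_Mapping.single v 1 + expo (?S - {u} - {v}))"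
        by (simp only: \<alpha>e[symmetric])
      then have "\<alpha> = expo (?S - {u} - {v}) + (Poly_Mapping.single u 1 + Poly_Mapping.single v 1)"
        by (simp add: ac_simps)
      moreover have "(Poly_Mapping.single (Poly_Mapping.single u 1 + Poly_Mapping.single v 1) 1 :: 'k mpoly)
          \<in> {Var i * Var j | i j. {i, j} \<in> E}"
        unfolding Var_mult[symmetric] using uv(4) by blast
      ultimately show ?thesis by (intro mem UnI2)
    qed
  qed
  then have "(\<Sum>\<alpha>\<in>Poly_Mapping.keys p. Poly_Mapping.single \<alpha> (Poly_Mapping.lookup p \<alpha>)) \<in> artin_ideal K N E"
    by (rule artin_ideal_sum)
  then show ?thesis using mpoly_sum_single[of "Poly_Mapping.keys p" p] by simp
qed

lemma homog_in_artin_ideal_iff: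
  fixes f :: "'k::comm_ring_1 mpoly"
  assumes f: "f \<in> homog_part N j"
  shows "f \<in> artin_ideal K N E \<longleftrightarrow> (\<forall>S\<in>ind E {1..N} j. Poly_Mapping.lookup f (expo S) = 0)"
proof
  assume "f \<in> artin_ideal K N E"
  then show "\<forall>S\<in>ind E {1..N} j. Poly_Mapping.lookup f (expo S) = 0"
    by (intro ballI lookup_artin_ideal) (auto simp: ind_def intro: finite_subset)
next
  assume z: "\<forall>S\<in>ind E {1..N} j. Poly_Mapping.lookup f (expo S) = 0"
  show "f \<in> artin_ideal K N E"
  proof (rule artin_idealI)
    fix S assume S: "S \<subseteq> {1..N}" "indep E S"
    have "finite S" using S(1) finite_subset by blast
    then have "mdeg (expo S) = card S" by (rule mdeg_expo)
    then show "Poly_Mapping.lookup f (expo S) = 0"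
      using z f S by (auto simp: homog_part_def ind_def in_keys_iff)
  qed (use f in \<open>simp add: homog_part_def\<close>)
qed

text \<open>Lifts arbitrary coordinates to a homogeneous polynomial; the terms at dependent sets lie
  in the ideal.\<close>

definition set_poly :: "nat \<Rightarrow> nat \<Rightarrow> (nat set \<Rightarrow> 'k::comm_ring_1) \<Rightarrow> 'k mpoly" where
  "set_poly N j f = (\<Sum>S | S \<subseteq> {1..N} \<and> card S = j. Poly_Mapping.single (expo S) (f S))"

lemma lookup_set_poly:
  assumes "S \<subseteq> {1..N}" "card S = j"
  shows "Poly_Mapping.lookup (set_poly N j f) (expo S) = f S"
proof -
  let ?A = "{S. S \<subseteq> {1..N} \<and> card S = j}"
  have fin: "finite ?A" by (rule finite_sub_card) simp
  have "Poly_Mapping.lookup (set_poly N j f) (expo S) = (\<Sum>R\<in>?A. f R when expo R = expo S)"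
    by (simp add: set_poly_def lookup_sum lookup_single)
  also have "\<dots> = (\<Sum>R\<in>?A. if R = S then f R else 0)"
  proof (intro sum.cong refl)
    fix R assume "R \<in> ?A"
    then have "finite R" "finite S" using assms finite_subset by auto
    then have "expo R = expo S \<longleftrightarrow> R = S" using keys_expo by metis
    then show "(f R when expo R = expo S) = (if R = S then f R else 0)" by (simp add: when_def)
  qed
  finally show ?thesis using fin assms by simp
qed

lemma keys_sum_subset: "Poly_Mapping.keys (\<Sum>x\<in>A. h x) \<subseteq> (\<Union>x\<in>A. Poly_Mapping.keys (h x))"
  by (induction A rule: infinite_finite_induct) (use keys_add in fastforce)+

lemma set_poly_homog: "set_poly N j f \<in> homog_part N j"
proof -
  have ex: "\<exists>S. S \<subseteq> {1..N} \<and> card S = j \<and> \<alpha> = expo S" if "\<alpha> \<in> Poly_Mapping.keys (set_poly N j f)" for \<alpha>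
    using that subsetD[OF keys_sum_subset, of \<alpha> "\<lambda>S. Poly_Mapping.single (expo S) (f S)"]
    unfolding set_poly_def by (auto split: if_splits)
  have "mdeg \<alpha> = j \<and> Poly_Mapping.keys \<alpha> \<subseteq> {1..N}"
    if \<alpha>: "\<alpha> \<in> Poly_Mapping.keys (set_poly N j f)" for \<alpha>
  proof -
    from ex[OF \<alpha>] obtain S where S: "S \<subseteq> {1..N}" "card S = j" "\<alpha> = expo S" by blast
    then have "finite S" using finite_subset by blast
    then show ?thesis using S by (simp add: keys_expo mdeg_expo)
  qed
  then show ?thesis by (simp add: homog_part_def polyring_def)
qed

lemma mdeg_add: "mdeg (\<alpha> + \<beta>) = mdeg \<alpha> + mdeg \<beta>"
proof -
  have eq: "mdeg \<gamma> = (\<Sum>i\<in>Poly_Mapping.keys \<alpha> \<union> Poly_Mapping.keys \<beta>. Poly_Mapping.lookup \<gamma> i)"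
    if "Poly_Mapping.keys \<gamma> \<subseteq> Poly_Mapping.keys \<alpha> \<union> Poly_Mapping.keys \<beta>" for \<gamma>
    unfolding mdeg_def using that by (intro sum.mono_neutral_left) (auto simp: in_keys_iff)
  show ?thesis using keys_add[of \<alpha> \<beta>] by (simp add: eq lookup_add sum.distrib)
qed

lemma homog_mult:
  fixes l f :: "'k::comm_ring_1 mpoly"
  assumes "l \<in> homog_part N i" "f \<in> homog_part N j"
  shows "l * f \<in> homog_part N (i + j)"
proof -
  have "mdeg \<gamma> = i + j \<and> Poly_Mapping.keys \<gamma> \<subseteq> {1..N}" if \<gamma>: "\<gamma> \<in> Poly_Mapping.keys (l * f)" for \<gamma>
  proof -
    obtain \<alpha> \<beta> where ab: "\<gamma> = \<alpha> + \<beta>" "\<alpha> \<in> Poly_Mapping.keys l" "\<beta> \<in> Poly_Mapping.keys f"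
      using subsetD[OF keys_mult \<gamma>] by blast
    have "Poly_Mapping.keys \<gamma> \<subseteq> Poly_Mapping.keys \<alpha> \<union> Poly_Mapping.keys \<beta>"
      unfolding ab(1) by (rule keys_add)
    moreover have "Poly_Mapping.keys \<alpha> \<subseteq> {1..N}" "Poly_Mapping.keys \<beta> \<subseteq> {1..N}"
      "mdeg \<alpha> = i" "mdeg \<beta> = j"
      using ab assms by (auto simp: homog_part_def polyring_def)
    ultimately show ?thesis unfolding ab(1) by (auto simp: mdeg_add)
  qed
  then show ?thesis by (auto simp: homog_part_def polyring_def)
qed

lemma homog_diff:
  fixes f g :: "'k::comm_ring_1 mpoly"
  assumes "f \<in> homog_part N j" "g \<in> homog_part N j"
  shows "f - g \<in> homog_part N j"
  using assms keys_diff[of f g] unfolding homog_part_def polyring_def by blast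

lemma mdeg_eq_1:
  assumes "mdeg \<alpha> = 1"
  obtains v where "v \<in> Poly_Mapping.keys \<alpha>" "\<alpha> = Poly_Mapping.single v 1"
proof -
  have "Poly_Mapping.keys \<alpha> \<noteq> {}" using assms by (auto simp: mdeg_def)
  then obtain v where v: "v \<in> Poly_Mapping.keys \<alpha>" by blast
  have "mdeg \<alpha> = Poly_Mapping.lookup \<alpha> v + (\<Sum>i\<in>Poly_Mapping.keys \<alpha> - {v}. Poly_Mapping.lookup \<alpha> i)"
    unfolding mdeg_def using v by (intro sum.remove) auto
  moreover have "Poly_Mapping.lookup \<alpha> v \<ge> 1" using v by (simp add: in_keys_iff Suc_le_eq)
  ultimately have 1: "Poly_Mapping.lookup \<alpha> v = 1"
    and 2: "(\<Sum>i\<in>Poly_Mapping.keys \<alpha> - {v}. Poly_Mapping.lookup \<alpha> i) = 0"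
    using assms by linarith+
  have "Poly_Mapping.lookup \<alpha> i = Poly_Mapping.lookup (Poly_Mapping.single v 1) i" for i
    using 1 2 by (cases "i = v") (auto simp: lookup_single in_keys_iff)
  then have "\<alpha> = Poly_Mapping.single v 1" by (rule poly_mapping_eqI)
  then show thesis using v that by blast
qed

lemma lookup_linear_mult:
  fixes l f :: "'k::comm_ring_1 mpoly"
  assumes l: "l \<in> homog_part N 1" and T: "T \<subseteq> {1..N}"
  shows "Poly_Mapping.lookup (l * f) (expo T)
    = (\<Sum>v\<in>T. Poly_Mapping.lookup l (Poly_Mapping.single v 1) * Poly_Mapping.lookup f (expo (T - {v})))"
proof -
  let ?s = "\<lambda>v. Poly_Mapping.single v 1 :: nat \<Rightarrow>\<^sub>0 nat"
  have fT: "finite T" using T finite_subset by blast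
  have "Poly_Mapping.keys l \<subseteq> ?s ` {1..N}"
  proof
    fix \<alpha> assume "\<alpha> \<in> Poly_Mapping.keys l"
    then have "mdeg \<alpha> = 1" "Poly_Mapping.keys \<alpha> \<subseteq> {1..N}"
      using l by (auto simp: homog_part_def polyring_def)
    then show "\<alpha> \<in> ?s ` {1..N}" by (metis mdeg_eq_1 image_eqI subsetD)
  qed
  then have "l = (\<Sum>\<alpha>\<in>?s ` {1..N}. Poly_Mapping.single \<alpha> (Poly_Mapping.lookup l \<alpha>))"
    by (intro mpoly_sum_single) auto
  also have "\<dots> = (\<Sum>v\<in>{1..N}. Poly_Mapping.single (?s v) (Poly_Mapping.lookup l (?s v)))"
    by (subst sum.reindex) (auto intro!: inj_onI dest: arg_cong[of _ _ Poly_Mapping.keys])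
  finally have "l * f = (\<Sum>v\<in>{1..N}. Poly_Mapping.single (?s v) (Poly_Mapping.lookup l (?s v))) * f"
    by (rule arg_cong[where f = "\<lambda>l. l * f"])
  then have "Poly_Mapping.lookup (l * f) (expo T)
      = (\<Sum>v\<in>{1..N}. Poly_Mapping.lookup (Poly_Mapping.single (?s v) (Poly_Mapping.lookup l (?s v)) * f) (expo T))"
    by (simp only: sum_distrib_right lookup_sum)
  also have "\<dots> = (\<Sum>v\<in>T. Poly_Mapping.lookup l (?s v) * Poly_Mapping.lookup f (expo (T - {v})))"
  proof (intro sum.mono_neutral_cong_right)
    show "\<forall>v\<in>{1..N} - T. Poly_Mapping.lookup
        (Poly_Mapping.single (?s v) (Poly_Mapping.lookup l (?s v)) * f) (expo T) = 0"
    proof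
      fix v assume v: "v \<in> {1..N} - T"
      have "expo T \<noteq> ?s v + \<delta>" for \<delta>
      proof
        assume "expo T = ?s v + \<delta>"
        then have "Poly_Mapping.lookup (expo T) v = 1 + Poly_Mapping.lookup \<delta> v"
          by (simp add: lookup_add)
        then show False using v fT by (simp add: lookup_expo)
      qed
      then show "Poly_Mapping.lookup
          (Poly_Mapping.single (?s v) (Poly_Mapping.lookup l (?s v)) * f) (expo T) = 0"
        by (rule lookup_single_mult_not)
    qed
    fix v assume "v \<in> T"
    then show "Poly_Mapping.lookup (Poly_Mapping.single (?s v) (Poly_Mapping.lookup l (?s v)) * f) (expo T)
        = Poly_Mapping.lookup l (?s v) * Poly_Mapping.lookup f (expo (T - {v}))"
      using fT by (simp add: expo_remove[of T v] lookup_single_mult_add)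
  qed (use T in auto)
  finally show ?thesis .
qed

lemma socle_degree_eq:
  "socle_degree (K :: 'k::comm_ring_1 itself) N E = (GREATEST j. ind E {1..N} j \<noteq> {})"
proof -
  have "(\<exists>f \<in> (homog_part N j :: 'k mpoly set). f \<notin> artin_ideal K N E) \<longleftrightarrow> ind E {1..N} j \<noteq> {}" for j
  proof
    assume "ind E {1..N} j \<noteq> {}"
    then obtain S where S: "S \<in> ind E {1..N} j" by blast
    then have "Poly_Mapping.lookup (set_poly N j (\<lambda>_. 1 :: 'k)) (expo S) = 1"
      by (intro lookup_set_poly) (auto simp: ind_def)
    then show "\<exists>f \<in> (homog_part N j :: 'k mpoly set). f \<notin> artin_ideal K N E"
      using S homog_in_artin_ideal_iff[OF set_poly_homog] by (metis set_poly_homog zero_neq_one)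
  qed (auto simp: homog_in_artin_ideal_iff)
  then show ?thesis by (simp add: socle_degree_def)
qed

text \<open>Only degrees below the socle degree count for the WLP, so a failure matters only where a
  larger independent set exists. The bound N on its size makes \<open>GREATEST\<close>
  meaningful.\<close>

lemma less_socle_degree:
  assumes "ind E {1..N} (Suc j) \<noteq> {}"
  shows "j < socle_degree (K :: 'k::comm_ring_1 itself) N E"
proof -
  have "i \<le> N" if "ind E {1..N} i \<noteq> {}" for i
    using that ind_empty_if[of "{1..N}" i E] by fastforce
  then have "Suc j \<le> (GREATEST j. ind E {1..N} j \<noteq> {})" using assms by (intro Greatest_le_nat) auto
  then show ?thesis by (simp add: socle_degree_eq)
qed

lemma has_WLP_iff:
  "has_WLP (K :: 'k::comm_ring_1 itself) N E \<longleftrightarrow>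
    (\<exists>a :: nat \<Rightarrow> 'k. \<forall>j < socle_degree K N E. lin_inj E N a j \<or> lin_sur E N a j)"
proof -
  let ?I = "artin_ideal K N E"
  let ?c = "\<lambda>l v. Poly_Mapping.lookup l (Poly_Mapping.single v 1)"
  have prod: "l * f - g \<in> ?I \<longleftrightarrow> (\<forall>T\<in>ind E {1..N} (Suc j). Poly_Mapping.lookup g (expo T)
      = (\<Sum>v\<in>T. ?c l v * Poly_Mapping.lookup f (expo (T - {v}))))"
    if l: "l \<in> homog_part N 1" and f: "f \<in> homog_part N j" and g: "g \<in> homog_part N (Suc j)"
    for l f g :: "'k mpoly" and j
  proof -
    have "l * f - g \<in> homog_part N (Suc j)" using homog_diff homog_mult[OF l f] g by simp
    then have "l * f - g \<in> ?I \<longleftrightarrow> (\<forall>T\<in>ind E {1..N} (Suc j). Poly_Mapping.lookup (l * f - g) (expo T) = 0)"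
      by (rule homog_in_artin_ideal_iff)
    also have "\<dots> \<longleftrightarrow> (\<forall>T\<in>ind E {1..N} (Suc j). Poly_Mapping.lookup g (expo T)
      = (\<Sum>v\<in>T. ?c l v * Poly_Mapping.lookup f (expo (T - {v}))))"
      by (intro ball_cong refl) (auto simp: ind_def lookup_minus lookup_linear_mult[OF l])
    finally show ?thesis .
  qed
  have zero: "(0 :: 'k mpoly) \<in> homog_part N j" for j by (simp add: homog_part_def polyring_def)
  have lkp: "(\<Sum>v\<in>T. a v * Poly_Mapping.lookup (set_poly N j h) (expo (T - {v}))) = (\<Sum>v\<in>T. a v * h (T - {v}))"
    if "T \<in> ind E {1..N} (Suc j)" for T j and h a :: "_ \<Rightarrow> 'k"
    using that finite_in_ind[OF _ that] by (intro sum.cong refl) (subst lookup_set_poly, auto simp: ind_def)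
  have inj: "(\<forall>f \<in> homog_part N j. l * f \<in> ?I \<longrightarrow> f \<in> ?I) \<longleftrightarrow> lin_inj E N (?c l) j"
    if l: "l \<in> homog_part N 1" for l :: "'k mpoly" and j
  proof
    assume L: "\<forall>f \<in> homog_part N j. l * f \<in> ?I \<longrightarrow> f \<in> ?I"
    show "lin_inj E N (?c l) j"
      unfolding lin_inj_def
    proof (intro allI impI)
      fix h :: "nat set \<Rightarrow> 'k"
      assume "\<forall>T\<in>ind E {1..N} (Suc j). (\<Sum>v\<in>T. ?c l v * h (T - {v})) = 0"
      then have "l * set_poly N j h \<in> ?I"
        using prod[OF l set_poly_homog zero, of j h] lkp by simp
      then have "set_poly N j h \<in> ?I" using L set_poly_homog by blast
      then have "\<forall>S\<in>ind E {1..N} j. Poly_Mapping.lookup (set_poly N j h) (expo S) = 0"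
        using homog_in_artin_ideal_iff[OF set_poly_homog] by blast
      then show "\<forall>S\<in>ind E {1..N} j. h S = 0" by (simp add: ind_def lookup_set_poly)
    qed
  next
    assume R: "lin_inj E N (?c l) j"
    show "\<forall>f \<in> homog_part N j. l * f \<in> ?I \<longrightarrow> f \<in> ?I"
    proof (intro ballI impI)
      fix f assume f: "f \<in> (homog_part N j :: 'k mpoly set)" and "l * f \<in> ?I"
      then have "\<forall>T\<in>ind E {1..N} (Suc j). (\<Sum>v\<in>T. ?c l v * Poly_Mapping.lookup f (expo (T - {v}))) = 0"
        using prod[OF l f zero] by simp
      then have "\<forall>S\<in>ind E {1..N} j. Poly_Mapping.lookup f (expo S) = 0"
        using R[unfolded lin_inj_def, rule_format, of "\<lambda>S. Poly_Mapping.lookup f (expo S)"] by blast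
      then show "f \<in> ?I" using homog_in_artin_ideal_iff[OF f] by blast
    qed
  qed
  have neg: "g - l * f \<in> ?I \<longleftrightarrow> l * f - g \<in> ?I"
    if l: "l \<in> homog_part N 1" and f: "f \<in> homog_part N j" and g: "g \<in> homog_part N (Suc j)"
    for l f g :: "'k mpoly" and j
  proof -
    have "l * f \<in> homog_part N (Suc j)" using homog_mult[OF l f] by simp
    then show ?thesis
      using homog_in_artin_ideal_iff[OF homog_diff, of "l * f" N "Suc j" g K E]
        homog_in_artin_ideal_iff[OF homog_diff, of g N "Suc j" "l * f" K E] g
      by (auto simp: lookup_minus)
  qed
  have sur: "(\<forall>g \<in> homog_part N (Suc j). \<exists>f \<in> homog_part N j. g - l * f \<in> ?I) \<longleftrightarrow> lin_sur E N (?c l) j"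
    if l: "l \<in> homog_part N 1" for l :: "'k mpoly" and j
  proof
    assume L: "\<forall>g \<in> homog_part N (Suc j). \<exists>f \<in> homog_part N j. g - l * f \<in> ?I"
    show "lin_sur E N (?c l) j"
      unfolding lin_sur_def
    proof
      fix h :: "nat set \<Rightarrow> 'k"
      obtain f where f: "f \<in> homog_part N j" "set_poly N (Suc j) h - l * f \<in> ?I"
        using L set_poly_homog by blast
      then have "\<forall>T\<in>ind E {1..N} (Suc j). Poly_Mapping.lookup (set_poly N (Suc j) h) (expo T)
          = (\<Sum>v\<in>T. ?c l v * Poly_Mapping.lookup f (expo (T - {v})))"
        using neg[OF l f(1) set_poly_homog] prod[OF l f(1) set_poly_homog] by blast
      then have "\<forall>T\<in>ind E {1..N} (Suc j). h T = (\<Sum>v\<in>T. ?c l v * Poly_Mapping.lookup f (expo (T - {v})))"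
        by (simp add: ind_def lookup_set_poly)
      then show "\<exists>f. \<forall>T\<in>ind E {1..N} (Suc j). h T = (\<Sum>v\<in>T. ?c l v * f (T - {v}))"
        by (intro exI[of _ "\<lambda>S. Poly_Mapping.lookup f (expo S)"])
    qed
  next
    assume R: "lin_sur E N (?c l) j"
    show "\<forall>g \<in> homog_part N (Suc j). \<exists>f \<in> homog_part N j. g - l * f \<in> ?I"
    proof
      fix g assume g: "g \<in> (homog_part N (Suc j) :: 'k mpoly set)"
      obtain h where h: "\<forall>T\<in>ind E {1..N} (Suc j). Poly_Mapping.lookup g (expo T)
          = (\<Sum>v\<in>T. ?c l v * h (T - {v}))"
        using R[unfolded lin_sur_def, rule_format, of "\<lambda>T. Poly_Mapping.lookup g (expo T)"] by blast
      then have "g - l * set_poly N j h \<in> ?I"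
        using neg[OF l set_poly_homog g] prod[OF l set_poly_homog g] lkp by simp
      then show "\<exists>f \<in> homog_part N j. g - l * f \<in> ?I" using set_poly_homog by blast
    qed
  qed
  have lin_poly: "\<exists>l \<in> homog_part N 1. \<forall>v\<in>{1..N}. ?c l v = a v" for a :: "nat \<Rightarrow> 'k"
  proof (intro bexI[of _ "set_poly N 1 (\<lambda>S. a (the_elem S))"] ballI)
    fix v assume "v \<in> {1..N}"
    then show "?c (set_poly N 1 (\<lambda>S. a (the_elem S))) v = a v"
      using lookup_set_poly[of "{v}" N 1 "\<lambda>S. a (the_elem S)"] by (simp add: expo_def)
  qed (rule set_poly_homog)
  have cong: "(\<Sum>v\<in>T. a v * h (T - {v})) = (\<Sum>v\<in>T. b v * h (T - {v}))"
    if "\<forall>v\<in>{1..N}. a v = b v" "T \<in> ind E {1..N} i" for a b :: "nat \<Rightarrow> 'k" and h T i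
    using that by (intro sum.cong) (auto simp: ind_def)
  have cong': "lin_inj E N a j = lin_inj E N b j" "lin_sur E N a j = lin_sur E N b j"
    if "\<forall>v\<in>{1..N}. a v = b v" for a b :: "nat \<Rightarrow> 'k" and j
    unfolding lin_inj_def lin_sur_def using cong[OF that] by simp_all
  have WLP: "has_WLP K N E \<longleftrightarrow> (\<exists>l\<in>homog_part N 1. \<forall>j < socle_degree K N E.
      lin_inj E N (?c (l :: 'k mpoly)) j \<or> lin_sur E N (?c l) j)"
    unfolding has_WLP_def by (intro bex_cong refl) (simp only: inj sur)
  show ?thesis
  proof
    assume "has_WLP K N E"
    then show "\<exists>a :: nat \<Rightarrow> 'k. \<forall>j < socle_degree K N E. lin_inj E N a j \<or> lin_sur E N a j"
      unfolding WLP by blast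
  next
    assume "\<exists>a :: nat \<Rightarrow> 'k. \<forall>j < socle_degree K N E. lin_inj E N a j \<or> lin_sur E N a j"
    then obtain a :: "nat \<Rightarrow> 'k" where
      a: "\<forall>j < socle_degree K N E. lin_inj E N a j \<or> lin_sur E N a j" by blast
    obtain l :: "'k mpoly" where l: "l \<in> homog_part N 1" "\<forall>v\<in>{1..N}. ?c l v = a v"
      using lin_poly[of a] by blast
    show "has_WLP K N E"
      unfolding WLP using a l(1) cong'[OF l(2)] by blast
  qed
qed

section \<open>Failure of injectivity\<close>

text \<open>The values lie in a ring, not a field, because the kernel element is built over
  k[t].\<close>

definition ker_up :: "nat set set \<Rightarrow> nat set \<Rightarrow> (nat \<Rightarrow> 'r::comm_ring_1) \<Rightarrow> nat \<Rightarrow> (nat set \<Rightarrow> 'r) \<Rightarrow> bool" where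
  "ker_up E V \<alpha> j F \<longleftrightarrow> (\<forall>T\<in>ind E V (Suc j). (\<Sum>v\<in>T. \<alpha> v * F (T - {v})) = 0)"

text \<open>Multiplication of an element of the kernel on V by a linear form c in the kernel on a disjoint
  block B. Edges between V and B do no harm, since adding edges only passes to a quotient algebra.\<close>

lemma ker_up_block:
  assumes "finite V" "finite B" "V \<inter> B = {}" and ker: "ker_up E V \<alpha> j F"
    and c: "\<And>x y. x \<in> B \<Longrightarrow> y \<in> B \<Longrightarrow> x \<noteq> y \<Longrightarrow> {x, y} \<notin> E \<Longrightarrow> \<alpha> x * c y + \<alpha> y * c x = 0"
  shows "ker_up E (V \<union> B) \<alpha> (Suc j) (\<lambda>T. if card (T \<inter> B) = 1 then F (T - B) * (\<Sum>b\<in>T \<inter> B. c b) else 0)"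
    (is "ker_up _ _ _ _ ?G")
  unfolding ker_up_def
proof
  fix T assume T: "T \<in> ind E (V \<union> B) (Suc (Suc j))"
  then have fT: "finite T" using finite_in_ind assms(1,2) by blast
  have split: "(\<Sum>v\<in>T. \<alpha> v * ?G (T - {v}))
      = (\<Sum>v\<in>T - B. \<alpha> v * ?G (T - {v})) + (\<Sum>v\<in>T \<inter> B. \<alpha> v * ?G (T - {v}))"
    using sum.Int_Diff[OF fT, of "\<lambda>v. \<alpha> v * ?G (T - {v})" B] by (simp add: add.commute)
  have V: "v \<in> T - B \<Longrightarrow> (T - {v}) \<inter> B = T \<inter> B" for v by auto
  have B: "v \<in> T \<inter> B \<Longrightarrow> (T - {v}) \<inter> B = T \<inter> B - {v}" for v by auto
  \<comment> \<open>The product is supported on sets meeting B once. Hence v contributes only if it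
    lies outside B and T meets B once, where F is in the kernel, or if it lies in B and T meets B
    twice, where the condition on c applies.\<close>
  consider "card (T \<inter> B) = 1" | "card (T \<inter> B) = 2" | "card (T \<inter> B) \<noteq> 1" "card (T \<inter> B) \<noteq> 2" by blast
  then show "(\<Sum>v\<in>T. \<alpha> v * ?G (T - {v})) = 0"
  proof cases
    case 1
    then obtain b where b: "T \<inter> B = {b}" by (auto simp: card_1_singleton_iff)
    have "T - B = T - {b}" "b \<in> T" using b by auto
    moreover have "card T = Suc (Suc j)" using T by (simp add: ind_def)
    ultimately have "card (T - B) = Suc j" by simp
    moreover have "T - B \<subseteq> V" "indep E (T - B)"
      using T indep_subset[of E T "T - B"] by (auto simp: ind_def)
    ultimately have "T - B \<in> ind E V (Suc j)" by (simp add: ind_def)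
    then have "(\<Sum>v\<in>T - B. \<alpha> v * F (T - B - {v})) = 0" using ker by (simp add: ker_up_def)
    moreover have "(\<Sum>v\<in>T - B. \<alpha> v * ?G (T - {v})) = (\<Sum>v\<in>T - B. \<alpha> v * F (T - B - {v})) * c b"
      unfolding sum_distrib_right
    proof (intro sum.cong refl)
      fix v assume v: "v \<in> T - B"
      have "T - {v} - B = T - B - {v}" by auto
      then show "\<alpha> v * ?G (T - {v}) = \<alpha> v * F (T - B - {v}) * c b"
        using V[OF v] b by simp
    qed
    moreover have "(\<Sum>v\<in>T \<inter> B. \<alpha> v * ?G (T - {v})) = 0"
      using B[of b] b by simp
    ultimately show ?thesis using split by simp
  next
    case 2
    then obtain x y where xy: "T \<inter> B = {x, y}" "x \<noteq> y" by (auto simp: card_2_iff)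
    have "\<alpha> v * ?G (T - {v}) = 0" if v: "v \<in> T - B" for v
      using V[OF v] 2 by simp
    then have "(\<Sum>v\<in>T - B. \<alpha> v * ?G (T - {v})) = 0" by (intro sum.neutral) simp
    moreover have "?G (T - {x}) = F (T - B) * c y" "?G (T - {y}) = F (T - B) * c x"
    proof -
      have "x \<in> T \<inter> B" "y \<in> T \<inter> B" using xy by auto
      then have e: "T - {x} - B = T - B" "T - {y} - B = T - B"
        "(T - {x}) \<inter> B = {y}" "(T - {y}) \<inter> B = {x}" using xy by auto
      show "?G (T - {x}) = F (T - B) * c y" "?G (T - {y}) = F (T - B) * c x" by (simp_all add: e)
    qed
    then have "(\<Sum>v\<in>T \<inter> B. \<alpha> v * ?G (T - {v})) = F (T - B) * (\<alpha> x * c y + \<alpha> y * c x)"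
      unfolding xy(1) using xy(2) by (simp add: algebra_simps)
    moreover have "{x, y} \<notin> E" using xy T unfolding ind_def indep_def by blast
    then have "\<alpha> x * c y + \<alpha> y * c x = 0" using xy by (intro c) auto
    ultimately show ?thesis using split by simp
  next
    case 3
    have "?G (T - {v}) = 0" if "v \<in> T" for v
    proof (cases "v \<in> B")
      case True
      then have "card ((T - {v}) \<inter> B) = card (T \<inter> B) - 1"
        using B[of v] that fT by simp
      moreover have "card (T \<inter> B) \<noteq> 0" using True that fT by auto
      ultimately show ?thesis using 3 by simp
    next
      case False
      then show ?thesis using V[of v] that 3 by simp
    qed
    then show ?thesis by (intro sum.neutral) simp
  qed
qed

text \<open>The coefficient of the product at \<open>insert b S\<close> is the single term F S * c
  b, nonzero in a domain.\<close>

lemma ker_up_block_nonzero: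
  fixes \<alpha> :: "nat \<Rightarrow> 'r::idom"
  assumes "finite V" "finite B" "V \<inter> B = {}" "ker_up E V \<alpha> j F" "S \<in> ind E V j" "F S \<noteq> 0"
    and "\<And>x y. x \<in> B \<Longrightarrow> y \<in> B \<Longrightarrow> x \<noteq> y \<Longrightarrow> {x, y} \<notin> E \<Longrightarrow> \<alpha> x * c y + \<alpha> y * c x = 0"
    and b: "b \<in> B" "c b \<noteq> 0" "\<And>s. s \<in> S \<Longrightarrow> {b, s} \<notin> E"
  obtains G where "ker_up E (V \<union> B) \<alpha> (Suc j) G" "insert b S \<in> ind E (V \<union> B) (Suc j)" "G (insert b S) \<noteq> 0"
proof
  show "ker_up E (V \<union> B) \<alpha> (Suc j) (\<lambda>T. if card (T \<inter> B) = 1 then F (T - B) * (\<Sum>b\<in>T \<inter> B. c b) else 0)"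
    using assms by (intro ker_up_block) auto
  have S: "S \<subseteq> V" "indep E S" "card S = j" "finite S"
    using assms(1,5) by (auto simp: ind_def intro: finite_subset)
  moreover have "b \<notin> S" using S b(1) assms(3) by auto
  ultimately show "insert b S \<in> ind E (V \<union> B) (Suc j)"
    using b by (auto simp: ind_def indep_insert)
  have "insert b S \<inter> B = {b}" "insert b S - B = S" using S b(1) assms(3) by auto
  then show "(if card (insert b S \<inter> B) = 1 then F (insert b S - B) * (\<Sum>b\<in>insert b S \<inter> B. c b) else 0) \<noteq> 0"
    using assms(6) b(2) by simp
qed

context
  fixes m :: nat
  assumes m: "m \<ge> 3"
begin

text \<open>On four consecutive vertices, the difference of the two halves of the linear form is annihilated
  by the form: their squares vanish.\<close>

lemma ker_up_quads:
  fixes \<alpha> :: "nat \<Rightarrow> 'r::idom"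
  assumes \<alpha>: "\<And>v. \<alpha> v \<noteq> 0" and q: "4 * q \<le> m + 3"
  shows "\<exists>F S. ker_up (tadpole_edges m 3) {1..4 * q} \<alpha> q F \<and> S \<in> ind (tadpole_edges m 3) {1..4 * q} q \<and> F S \<noteq> 0 \<and> S \<subseteq> {2..4 * q - 2}"
  using q
proof (induction q)
  case 0
  have "ker_up (tadpole_edges m 3) {1..4 * 0} \<alpha> 0 (\<lambda>_. 1)" by (auto simp: ker_up_def ind_def)
  moreover have "{} \<in> ind (tadpole_edges m 3) {1..4 * 0} 0" by (simp add: ind_def indep_def)
  ultimately show ?case by force
next
  case (Suc q)
  then obtain F S where F: "ker_up (tadpole_edges m 3) {1..4 * q} \<alpha> q F" "S \<in> ind (tadpole_edges m 3) {1..4 * q} q" "F S \<noteq> 0"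
    and S: "S \<subseteq> {2..4 * q - 2}" by auto
  let ?B = "{4 * q + 1..4 * q + 4}"
  let ?c = "\<lambda>x. if x \<le> 4 * q + 2 then \<alpha> x else - \<alpha> x"
  have un: "{1..4 * q} \<union> ?B = {1..4 * Suc q}" by auto
  \<comment> \<open>The bounds on S serve here: starting at 2 avoids the chord, and ending at 4q - 2
    leaves room before 4q + 2.\<close>
  have nadj: "{4 * q + 2, s} \<notin> (tadpole_edges m 3)" if "s \<in> S" for s
    using subsetD[OF S that] m by (auto simp: tadpole_edges_iff)
  have c0: "\<alpha> x * ?c y + \<alpha> y * ?c x = 0"
    if xy: "x \<in> ?B" "y \<in> ?B" "x \<noteq> y" "{x, y} \<notin> (tadpole_edges m 3)" for x y
  proof -
    have "\<not> (y = Suc x) \<and> \<not> (x = Suc y)" using xy Suc.prems m by (auto simp: tadpole_edges_iff)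
    then have "(x \<le> 4 * q + 2) \<noteq> (y \<le> 4 * q + 2)" using xy(1-3) by auto
    then show ?thesis by (auto simp: mult.commute)
  qed
  obtain G where "ker_up (tadpole_edges m 3) ({1..4 * q} \<union> ?B) \<alpha> (Suc q) G"
    "insert (4 * q + 2) S \<in> ind (tadpole_edges m 3) ({1..4 * q} \<union> ?B) (Suc q)"
    "G (insert (4 * q + 2) S) \<noteq> 0"
  proof (rule ker_up_block_nonzero[OF _ _ _ F])
    show "\<alpha> x * ?c y + \<alpha> y * ?c x = 0"
      if "x \<in> ?B" "y \<in> ?B" "x \<noteq> y" "{x, y} \<notin> tadpole_edges m 3" for x y
      using c0[OF that] .
    show "{4 * q + 2, s} \<notin> tadpole_edges m 3" if "s \<in> S" for s using nadj[OF that] .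
  qed (use \<alpha> in auto)
  note G = this[unfolded un]
  moreover have "{2..4 * q - 2} \<subseteq> {2..4 * Suc q - 2}" by auto
  then have "insert (4 * q + 2) S \<subseteq> {2..4 * Suc q - 2}" using S by auto
  ultimately show ?case by blast
qed

text \<open>(m + 6) div 4 is (m + 3)/4 rounded up: each full block of four contributes a linear
  factor, and so does an incomplete last block.\<close>

lemma ker_up_tadpole:
  fixes \<alpha> :: "nat \<Rightarrow> 'r::idom"
  assumes \<alpha>: "\<And>v. \<alpha> v \<noteq> 0"
  shows "\<exists>F S. ker_up (tadpole_edges m 3) {1..m + 3} \<alpha> ((m + 6) div 4) F \<and> S \<in> ind (tadpole_edges m 3) {1..m + 3} ((m + 6) div 4) \<and> F S \<noteq> 0"
proof -
  define q where "q = (m + 3) div 4"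
  define r where "r = (m + 3) mod 4"
  have qr: "m + 3 = 4 * q + r" "r < 4" by (simp_all add: q_def r_def)
  have q1: "q \<ge> 1" using m by (simp add: q_def)
  obtain F S where F: "ker_up (tadpole_edges m 3) {1..4 * q} \<alpha> q F" "S \<in> ind (tadpole_edges m 3) {1..4 * q} q" "F S \<noteq> 0"
    and S: "S \<subseteq> {2..4 * q - 2}"
    using ker_up_quads[where \<alpha> = \<alpha>, OF \<alpha>, of q] qr(1) by auto
  show ?thesis
  proof (cases "r = 0")
    case True
    then have "m + 3 = 4 * q" "(m + 6) div 4 = q" using qr by auto
    then show ?thesis using F by auto
  next
    case False
    \<comment> \<open>In a block of at most three vertices b is adjacent to all others, so the
      variable of b is annihilated by the form on the block.\<close>
    define b where "b = 4 * q + min r 2"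
    let ?B = "{4 * q + 1..4 * q + r}"
    let ?c = "\<lambda>x. if x = b then 1 else 0 :: 'r"
    have un: "{1..4 * q} \<union> ?B = {1..m + 3}" using qr(1) by auto
    have deg: "(m + 6) div 4 = Suc q" using qr False by auto
    have nadj: "{b, s} \<notin> (tadpole_edges m 3)" if "s \<in> S" for s
      using subsetD[OF S that] m q1 False unfolding b_def by (auto simp: tadpole_edges_iff)
    have c0: "\<alpha> x * ?c y + \<alpha> y * ?c x = 0"
      if xy: "x \<in> ?B" "y \<in> ?B" "x \<noteq> y" "{x, y} \<notin> (tadpole_edges m 3)" for x y
    proof -
      have "\<not> (y = Suc x) \<and> \<not> (x = Suc y)" using xy qr(1) m by (auto simp: tadpole_edges_iff)
      then have "x \<noteq> b \<and> y \<noteq> b" using xy(1-3) qr(2) unfolding b_def by auto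
      then show ?thesis by simp
    qed
    obtain G where "ker_up (tadpole_edges m 3) ({1..4 * q} \<union> ?B) \<alpha> (Suc q) G"
      "insert b S \<in> ind (tadpole_edges m 3) ({1..4 * q} \<union> ?B) (Suc q)" "G (insert b S) \<noteq> 0"
    proof (rule ker_up_block_nonzero[OF _ _ _ F])
      show "\<alpha> x * ?c y + \<alpha> y * ?c x = 0"
        if "x \<in> ?B" "y \<in> ?B" "x \<noteq> y" "{x, y} \<notin> tadpole_edges m 3" for x y
        using c0[OF that] .
      show "{b, s} \<notin> tadpole_edges m 3" if "s \<in> S" for s using nadj[OF that] .
      show "b \<in> ?B" using False by (auto simp: b_def)
    qed auto
    then show ?thesis unfolding deg un by blast
  qed
qed

text \<open>Coefficients of the form that vanish are perturbed to a + t; the lowest coefficient with respect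
  to t of a kernel element of the perturbed form lies in the kernel of the original one.\<close>

lemma not_lin_inj_tadpole:
  fixes a :: "nat \<Rightarrow> 'k::field"
  shows "\<not> lin_inj (tadpole_edges m 3) (m + 3) a ((m + 6) div 4)"
proof
  let ?j = "(m + 6) div 4" and ?V = "{1..m + 3}"
  assume inj: "lin_inj (tadpole_edges m 3) (m + 3) a ?j"
  obtain F S where F: "ker_up (tadpole_edges m 3) ?V (\<lambda>v. [:a v, 1:]) ?j F" and S: "S \<in> ind (tadpole_edges m 3) ?V ?j" "F S \<noteq> 0"
    using ker_up_tadpole[of "\<lambda>v. [:a v, 1:]"] by auto
  define P where "P n \<longleftrightarrow> (\<exists>S\<in>ind (tadpole_edges m 3) ?V ?j. coeff (F S) n \<noteq> 0)" for n
  define n0 where "n0 = (LEAST n. P n)"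
  have "\<exists>n. coeff (F S) n \<noteq> 0" using S(2) by (auto simp: poly_eq_iff)
  then have "\<exists>n. P n" using S(1) unfolding P_def by blast
  then have n0: "P n0" unfolding n0_def by (rule LeastI_ex)
  have min: "coeff (F R) n = 0" if "n < n0" "R \<in> ind (tadpole_edges m 3) ?V ?j" for n R
    using not_less_Least[of n P] that unfolding n0_def P_def by blast
  have "(\<Sum>v\<in>T. a v * coeff (F (T - {v})) n0) = 0" if T: "T \<in> ind (tadpole_edges m 3) ?V (Suc ?j)" for T
  proof -
    have fT: "finite T" using T finite_in_ind by blast
    \<comment> \<open>The extra summand from t is the coefficient at n0 - 1, zero by minimality of
      n0.\<close>
    have "a v * coeff (F (T - {v})) n0 = coeff ([:a v, 1:] * F (T - {v})) n0" if v: "v \<in> T" for v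
    proof -
      have "T - {v} \<in> ind (tadpole_edges m 3) ?V ?j" using T v fT by (intro ind_subset[OF T]) (auto simp: ind_def)
      then have "n0 \<noteq> 0 \<Longrightarrow> coeff (F (T - {v})) (n0 - 1) = 0" using min by simp
      then show ?thesis by (auto simp: coeff_pCons split: nat.split)
    qed
    then have "(\<Sum>v\<in>T. a v * coeff (F (T - {v})) n0) = coeff (\<Sum>v\<in>T. [:a v, 1:] * F (T - {v})) n0"
      by (simp add: coeff_sum)
    also have "\<dots> = 0" using F T by (simp add: ker_up_def)
    finally show ?thesis .
  qed
  then have "\<forall>S\<in>ind (tadpole_edges m 3) ?V ?j. coeff (F S) n0 = 0"
    using inj[unfolded lin_inj_def, rule_format, of "\<lambda>S. coeff (F S) n0"] by blast
  then show False using n0 unfolding P_def by blast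
qed

end

section \<open>Failure of surjectivity\<close>

text \<open>The functional attached to a list of disjoint edges: for each edge it contains a factor that
  annihilates the form restricted to the edge.\<close>

definition lc :: "(nat \<Rightarrow> 'k::comm_ring_1) \<Rightarrow> nat \<Rightarrow> nat \<Rightarrow> 'k" where
  "lc a u v = (if a u = 0 \<and> a v = 0 then 1 else a v)"

text \<open>Together with \<open>lc\<close> a nonzero vector orthogonal to (a u, a v); if both
  coefficients vanish, (1, 0) is chosen.\<close>

definition rc :: "(nat \<Rightarrow> 'k::comm_ring_1) \<Rightarrow> nat \<Rightarrow> nat \<Rightarrow> 'k" where
  "rc a u v = (if a u = 0 \<and> a v = 0 then 0 else - a u)"

fun trans_sets :: "(nat \<times> nat) list \<Rightarrow> nat set set" where
  "trans_sets [] = {{}}"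
| "trans_sets ((u, v) # es) = insert u ` trans_sets es \<union> insert v ` trans_sets es"

fun edge_functional :: "(nat \<Rightarrow> 'k::comm_ring_1) \<Rightarrow> (nat \<times> nat) list \<Rightarrow> (nat set \<Rightarrow> 'k) \<Rightarrow> 'k" where
  "edge_functional a [] h = h {}"
| "edge_functional a ((u, v) # es) h =
    lc a u v * edge_functional a es (\<lambda>S. h (insert u S)) + rc a u v * edge_functional a es (\<lambda>S. h (insert v S))"

fun disjoint_edges :: "(nat \<times> nat) list \<Rightarrow> bool" where
  "disjoint_edges [] = True"
| "disjoint_edges ((u, v) # es) = (u \<noteq> v \<and> (\<forall>T\<in>trans_sets es. u \<notin> T \<and> v \<notin> T) \<and> disjoint_edges es)"

lemma finite_trans_sets: "T \<in> trans_sets es \<Longrightarrow> finite T"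
  by (induction es arbitrary: T rule: trans_sets.induct) auto

lemma edge_functional_cong:
  "(\<And>T. T \<in> trans_sets es \<Longrightarrow> h T = h' T) \<Longrightarrow> edge_functional a es h = edge_functional a es h'"
proof (induction es arbitrary: h h' rule: trans_sets.induct)
  case (2 u v es)
  have "edge_functional a es (\<lambda>S. h (insert x S)) = edge_functional a es (\<lambda>S. h' (insert x S))"
    if "x \<in> {u, v}" for x
    using that "2.prems" by (intro 2) auto
  then show ?case by simp
qed simp

lemma edge_functional_add:
  "edge_functional a es (\<lambda>S. h S + h' S) = edge_functional a es h + edge_functional a es h'"
  by (induction es arbitrary: h h' rule: trans_sets.induct) (simp_all add: algebra_simps)

lemma edge_functional_scale:
  "edge_functional a es (\<lambda>S. c * h S) = c * edge_functional a es h"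
  by (induction es arbitrary: h rule: trans_sets.induct) (simp_all add: algebra_simps)

text \<open>At \<open>insert w S\<close> the product with the form is \<open>a w * f S\<close> plus
  a product over S, which induction kills. The total factor of the first edge is its orthogonality
  relation, hence zero.\<close>

lemma edge_functional_image:
  assumes "disjoint_edges es"
  shows "edge_functional a es (\<lambda>T. \<Sum>x\<in>T. a x * f (T - {x})) = 0"
  using assms
proof (induction es arbitrary: f rule: trans_sets.induct)
  case (2 u v es)
  have d: "disjoint_edges es" using "2.prems" by simp
  have *: "edge_functional a es (\<lambda>S. \<Sum>x\<in>insert w S. a x * f (insert w S - {x})) = a w * edge_functional a es f"
    if w: "\<forall>T\<in>trans_sets es. w \<notin> T" for w
  proof -
    have "edge_functional a es (\<lambda>S. \<Sum>x\<in>insert w S. a x * f (insert w S - {x}))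
        = edge_functional a es (\<lambda>S. a w * f S + (\<Sum>x\<in>S. a x * f (insert w (S - {x}))))"
    proof (rule edge_functional_cong)
      fix S assume S: "S \<in> trans_sets es"
      then have "w \<notin> S" "finite S" using w finite_trans_sets by auto
      moreover from this have "insert w S - {x} = insert w (S - {x})" if "x \<in> S" for x using that by auto
      ultimately show "(\<Sum>x\<in>insert w S. a x * f (insert w S - {x}))
          = a w * f S + (\<Sum>x\<in>S. a x * f (insert w (S - {x})))"
        by simp
    qed
    also have "\<dots> = a w * edge_functional a es f"
      using 2(1)[OF d, of "\<lambda>S. f (insert w S)"] by (simp add: edge_functional_add edge_functional_scale)
    finally show ?thesis .
  qed
  have "edge_functional a ((u, v) # es) (\<lambda>T. \<Sum>x\<in>T. a x * f (T - {x}))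
      = (lc a u v * a u + rc a u v * a v) * edge_functional a es f"
    using *[of u] *[of v] "2.prems" by (simp add: algebra_simps)
  also have "lc a u v * a u + rc a u v * a v = 0" by (simp add: lc_def rc_def)
  finally show ?case by simp
qed simp

lemma edge_functional_nonzero:
  fixes a :: "nat \<Rightarrow> 'k::field"
  assumes "disjoint_edges es"
  shows "\<exists>h. edge_functional a es h \<noteq> 0"
  using assms
proof (induction es rule: trans_sets.induct)
  case (2 u v es)
  then obtain h where h: "edge_functional a es h \<noteq> 0" by auto
  have zero: "edge_functional a es (\<lambda>_. 0) = 0"
    using edge_functional_scale[of a es 0 "\<lambda>_. 0"] by simp
  \<comment> \<open>\<open>g w\<close> reads h off the transversals through w and so isolates the
    coefficient of w at the first edge.\<close>
  define g where "g w S = (if w \<in> S then h (S - {w}) else 0)" for w S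
  have g1: "edge_functional a es (\<lambda>S. g w (insert w S)) = edge_functional a es h"
    if "\<forall>T\<in>trans_sets es. w \<notin> T" for w
    using that by (intro edge_functional_cong) (auto simp: g_def)
  have g2: "edge_functional a es (\<lambda>S. g w (insert w' S)) = 0"
    if "\<forall>T\<in>trans_sets es. w \<notin> T" "w \<noteq> w'" for w w'
  proof -
    have "edge_functional a es (\<lambda>S. g w (insert w' S)) = edge_functional a es (\<lambda>_. 0)"
      using that by (intro edge_functional_cong) (auto simp: g_def)
    then show ?thesis using zero by simp
  qed
  have "edge_functional a ((u, v) # es) (g u) = lc a u v * edge_functional a es h"
    "edge_functional a ((u, v) # es) (g v) = rc a u v * edge_functional a es h"
    using "2.prems" g1[of u] g1[of v] g2[of u v] g2[of v u] by simp_all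
  moreover have "lc a u v \<noteq> 0 \<or> rc a u v \<noteq> 0" by (auto simp: lc_def rc_def)
  ultimately show ?case using h by (metis mult_eq_0_iff)
qed (auto intro: exI[of _ "\<lambda>_. 1"])

text \<open>The functional annihilates the image but is nonzero. It may read only coordinates at
  independent sets, which is where the matching has to be induced.\<close>

lemma not_lin_sur:
  fixes a :: "nat \<Rightarrow> 'k::field"
  assumes "disjoint_edges es" "trans_sets es \<subseteq> ind E {1..N} (Suc j)"
  shows "\<not> lin_sur E N a j"
proof
  assume sur: "lin_sur E N a j"
  obtain h where h: "edge_functional a es h \<noteq> 0" using edge_functional_nonzero[OF assms(1)] by blast
  obtain f where "\<forall>T\<in>ind E {1..N} (Suc j). h T = (\<Sum>v\<in>T. a v * f (T - {v}))"
    using sur unfolding lin_sur_def by blast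
  then have "edge_functional a es h = edge_functional a es (\<lambda>T. \<Sum>v\<in>T. a v * f (T - {v}))"
    using assms(2) by (intro edge_functional_cong) auto
  then show False using h edge_functional_image[OF assms(1), of a f] by simp
qed

text \<open>These edges avoid m if 3i is at most m, so the chord {1, m} does not matter and they form an induced
  matching.\<close>

fun pairs :: "nat \<Rightarrow> (nat \<times> nat) list" where
  "pairs 0 = []"
| "pairs (Suc i) = (3 * i + 1, 3 * i + 2) # pairs i"

lemma trans_sets_pairs:
  assumes "m \<ge> 3" "3 * i \<le> m" "T \<in> trans_sets (pairs i)"
  shows "T \<subseteq> {1..<3 * i} \<and> indep (tadpole_edges m 3) T \<and> card T = i"
  using assms(2,3)
proof (induction i arbitrary: T)
  case (Suc i)
  then obtain S b where S: "S \<in> trans_sets (pairs i)" and T: "T = insert b S"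
    and b: "b = 3 * i + 1 \<or> b = 3 * i + 2" by auto
  have IH: "S \<subseteq> {1..<3 * i}" "indep (tadpole_edges m 3) S" "card S = i"
    using Suc.IH[OF _ S] Suc.prems by auto
  have "{b, s} \<notin> tadpole_edges m 3" if "s \<in> S" for s
    using subsetD[OF IH(1) that] b Suc.prems(1) assms(1) by (auto simp: tadpole_edges_iff)
  moreover have "b \<notin> S" "finite S" using IH(1) b finite_subset by auto
  ultimately show ?case using IH b unfolding T by (auto simp: indep_insert)
qed (simp add: indep_def)

lemma disjoint_edges_pairs:
  assumes "m \<ge> 3" "3 * i \<le> m"
  shows "disjoint_edges (pairs i)"
  using assms(2)
proof (induction i)
  case (Suc i)
  have "3 * i + 1 \<notin> T \<and> 3 * i + 2 \<notin> T" if "T \<in> trans_sets (pairs i)" for T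
    using trans_sets_pairs[OF assms(1) _ that] Suc.prems by auto
  then show ?case using Suc by simp
qed simp

text \<open>The extra edge is y_2 y_3, separated from the cycle by y_1. The second claim places
  degree j below the socle degree.\<close>

lemma not_lin_sur_tadpole:
  fixes a :: "nat \<Rightarrow> 'k::field"
  assumes m: "m \<ge> 3" and j: "j \<le> m div 3"
  shows "\<not> lin_sur (tadpole_edges m 3) (m + 3) a j"
    and "ind (tadpole_edges m 3) {1..m + 3} (Suc j) \<noteq> {}"
proof -
  let ?E = "tadpole_edges m 3" and ?es = "(m + 2, m + 3) # pairs j"
  have j3: "3 * j \<le> m" using j by linarith
  note P = trans_sets_pairs[OF m j3]
  have "m + 2 \<notin> T \<and> m + 3 \<notin> T" if "T \<in> trans_sets (pairs j)" for T
    using P[OF that] j3 by auto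
  then have dis: "disjoint_edges ?es" using disjoint_edges_pairs[OF m j3] by simp
  have sub: "trans_sets ?es \<subseteq> ind ?E {1..m + 3} (Suc j)"
  proof
    fix T assume "T \<in> trans_sets ?es"
    then obtain S b where S: "S \<in> trans_sets (pairs j)" and T: "T = insert b S"
      and b: "b = m + 2 \<or> b = m + 3" by auto
    have IH: "S \<subseteq> {1..<m}" "indep ?E S" "card S = j" using P[OF S] j3 by auto
    have "{b, s} \<notin> ?E" if "s \<in> S" for s
      using subsetD[OF IH(1) that] b m by (auto simp: tadpole_edges_iff)
    moreover have "b \<notin> S" "finite S" using IH(1) b finite_subset by auto
    moreover have "S \<subseteq> {1..m + 3}" using IH(1) by auto
    ultimately show "T \<in> ind ?E {1..m + 3} (Suc j)"
      using IH b m unfolding T by (auto simp: indep_insert ind_def)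
  qed
  show "\<not> lin_sur ?E (m + 3) a j" by (rule not_lin_sur[OF dis sub])
  have "trans_sets es \<noteq> {}" for es by (induction es rule: trans_sets.induct) auto
  then show "ind ?E {1..m + 3} (Suc j) \<noteq> {}" using sub by blast
qed

section \<open>Comparison of the two obstructions, and the finite list\<close>

theorem theorem4p2:
  fixes m :: nat
  assumes "m \<ge> 3"
  shows "has_WLP TYPE('k::field_char_0) (m + 3) (tadpole_edges m 3)
           \<longleftrightarrow> m \<in> {3, 4, 5, 6, 7, 8, 10, 11, 14}"
proof
  assume WLP: "has_WLP TYPE('k) (m + 3) (tadpole_edges m 3)"
  show "m \<in> {3, 4, 5, 6, 7, 8, 10, 11, 14}"
  proof (rule ccontr)
    assume n: "m \<notin> {3, 4, 5, 6, 7, 8, 10, 11, 14}"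
    \<comment> \<open>The estimate (m + 6)/4 \<le> (m - 2)/3 holds from m = 26 on; smaller m are
      inspected.\<close>
    have le: "(m + 6) div 4 \<le> m div 3"
    proof (cases "m < 26")
      case True
      then have "m \<in> {3..<26}" using assms by simp
      then have "m \<in> {9, 12, 13, 15, 16, 17, 18, 19, 20, 21, 22, 23, 24, 25}"
        using n by (simp add: atLeastLessThan_nat_numeral) presburger
      then show ?thesis by auto
    qed linarith
    obtain a :: "nat \<Rightarrow> 'k" where "\<forall>j < socle_degree TYPE('k) (m + 3) (tadpole_edges m 3).
        lin_inj (tadpole_edges m 3) (m + 3) a j \<or> lin_sur (tadpole_edges m 3) (m + 3) a j"
      using WLP has_WLP_iff by blast
    \<comment> \<open>Both failures are taken in the same degree (m + 6) div 4, whatever the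
      form.\<close>
    then show False
      using less_socle_degree[OF not_lin_sur_tadpole(2)[OF assms le]] not_lin_inj_tadpole[OF assms]
        not_lin_sur_tadpole(1)[OF assms le] by blast
  qed
next
  assume n: "m \<in> {3, 4, 5, 6, 7, 8, 10, 11, 14}"
  have "lin_inj (tadpole_edges m 3) (m + 3) (\<lambda>_. 1 :: 'k) j
      \<or> lin_sur (tadpole_edges m 3) (m + 3) (\<lambda>_. 1 :: 'k) j" for j
  proof (cases "j < first_sur m")
    case True
    then show ?thesis using lin_inj_if_inj_pow[OF tadpole_inj_list[where 'k = 'k, OF n True]] by simp
  next
    case False
    then show ?thesis using lin_sur_if_sur_pow[OF tadpole_sur_list[where 'k = 'k, OF n, of j]] by simp
  qed
  then show "has_WLP TYPE('k) (m + 3) (tadpole_edges m 3)" unfolding has_WLP_iff by blast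
qed

end
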